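(* Let $g$ and $\bar g$ be Riemannian metrics on an $m$-dimensional manifold $M$ which are $PQ^{\epsilon}$-projective (for some $(1,1)$-tensors $P,Q$ and a real number $\epsilon\neq 1,m+1$ satisfying the compatibility conditions). If $\epsilon=0$, then $g$ and $\bar g$ are projectively equivalent.
   Context: Let $g,\bar g$ be (positive definite) Riemannian metrics on a smooth $m$-dimensional manifold $M$ with Levi-Civita connections $\nabla,\bar\nabla$. Let $P,Q$ be $(1,1)$-tensors on $M$ (endomorphism fields of $TM$) and $\epsilon$ a real number (a constant), $\epsilon\neq 1$ and $\epsilon\neq m+1$, satisfying the compatibility conditions $$g(PX,Y)=-g(X,PY),\quad g(QX,Y)=-g(X,QY),\quad \bar g(PX,Y)=-\bar g(X,PY),\quad \bar g(QX,Y)=-\bar g(X,QY),\quad PQ=\epsilon\, Id,$$ for all $X,Y$, where $Id$ is the identity on $TM$. The metrics $g,\bar g$ are called $PQ^{\epsilon}$-projective if there is a $1$-form $\Phi$ on $M$ such that for all vector fields $X,Y$ $$\bar\nabla_XY-\nabla_XY=\Phi(X)Y+\Phi(Y)X-\Phi(PX)QY-\Phi(PY)QX .$$ The metrics $g,\bar g$ are called projectively equivalent if they have the same geodesics considered as unparametrized curves; by Levi-Civita this is equivalent to the existence of a $1$-form $\Phi$ on $M$ with $\bar\nabla_XY-\nabla_XY=\Phi(X)Y+\Phi(Y)X$ for all vector fields $X,Y$. *)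

theory Defs
  imports "HOL-Analysis.Analysis"
begin

text \<open>Only meant for open \<open>S\<close>. As the domain has finite dimension, \<open>f\<close> is of class \<open>C\<^sup>k\<^sup>+\<^sup>1\<close>
  iff it is differentiable and its directional derivatives are of class \<open>C\<^sup>k\<close>.\<close>

primrec Ck_on :: "nat \<Rightarrow> 'a::euclidean_space set \<Rightarrow> ('a \<Rightarrow> 'b::real_normed_vector) \<Rightarrow> bool" where
  "Ck_on 0 S f = continuous_on S f"
| "Ck_on (Suc k) S f =
     ((\<forall>x\<in>S. f differentiable at x) \<and> (\<forall>v. Ck_on k S (\<lambda>x. frechet_derivative f (at x) v)))"

definition smooth_on :: "'a::euclidean_space set \<Rightarrow> ('a \<Rightarrow> 'b::real_normed_vector) \<Rightarrow> bool" where
  "smooth_on S f \<longleftrightarrow> (\<forall>k. Ck_on k S f)"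

text \<open>A chart is a domain together with a coordinate map into the model space \<open>'e\<close>; the dimension
  of a manifold modelled on \<open>'e\<close> is \<open>DIM('e)\<close>. The atlas need not be maximal.\<close>

type_synonym ('a, 'e) chart = "'a set \<times> ('a \<Rightarrow> 'e)"

record ('a, 'e) manifold =
  mtop :: "'a topology"
  atlas :: "('a, 'e) chart set"

abbreviation points :: "('a, 'e, 'z) manifold_scheme \<Rightarrow> 'a set" where
  "points M \<equiv> topspace (mtop M)"

abbreviation chart_dom :: "('a, 'e) chart \<Rightarrow> 'a set" where
  "chart_dom c \<equiv> fst c"

abbreviation chart_map :: "('a, 'e) chart \<Rightarrow> 'a \<Rightarrow> 'e" where
  "chart_map c \<equiv> snd c"

definition chart_inv :: "('a, 'e) chart \<Rightarrow> 'e \<Rightarrow> 'a" where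
  "chart_inv c = inv_into (chart_dom c) (chart_map c)"

definition is_chart :: "'a topology \<Rightarrow> ('a, 'e::euclidean_space) chart \<Rightarrow> bool" where
  "is_chart T c \<longleftrightarrow>
     openin T (chart_dom c) \<and> open (chart_map c ` chart_dom c) \<and>
     homeomorphic_map (subtopology T (chart_dom c)) (top_of_set (chart_map c ` chart_dom c))
       (chart_map c)"

definition smooth_manifold :: "('a, 'e::euclidean_space) manifold \<Rightarrow> bool" where
  "smooth_manifold M \<longleftrightarrow>
     Hausdorff_space (mtop M) \<and> second_countable (mtop M) \<and>
     (\<forall>c\<in>atlas M. is_chart (mtop M) c) \<and>
     (\<Union>c\<in>atlas M. chart_dom c) = points M \<and>
     (\<forall>c\<in>atlas M. \<forall>d\<in>atlas M.
        smooth_on (chart_map c ` (chart_dom c \<inter> chart_dom d)) (chart_map d \<circ> chart_inv c))"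

text \<open>The tangent space at \<open>p\<close> is the model space \<open>'e\<close>, a tangent vector being given by its
  components in the selected chart \<open>chart_at M p\<close>. This trivialization varies discontinuously with
  \<open>p\<close>, so smoothness of a field is tested on its components \<open>tangent_coord M c p\<close> in the charts
  \<open>c\<close> of the atlas, which are obtained from the selected ones by the derivative of the coordinate
  change. The values of fields outside \<open>points M\<close> are irrelevant.\<close>

definition chart_at :: "('a, 'e::euclidean_space) manifold \<Rightarrow> 'a \<Rightarrow> ('a, 'e) chart" where
  "chart_at M p = (SOME c. c \<in> atlas M \<and> p \<in> chart_dom c)"

definition tangent_coord ::
  "('a, 'e::euclidean_space) manifold \<Rightarrow> ('a, 'e) chart \<Rightarrow> 'a \<Rightarrow> 'e \<Rightarrow> 'e" where
  "tangent_coord M c p v =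
     frechet_derivative (chart_map c \<circ> chart_inv (chart_at M p)) (at (chart_map (chart_at M p) p)) v"

definition smooth_fun :: "('a, 'e::euclidean_space) manifold \<Rightarrow> ('a \<Rightarrow> real) \<Rightarrow> bool" where
  "smooth_fun M f \<longleftrightarrow>
     (\<forall>c\<in>atlas M. smooth_on (chart_map c ` chart_dom c) (f \<circ> chart_inv c))"

definition vector_field :: "('a, 'e::euclidean_space) manifold \<Rightarrow> ('a \<Rightarrow> 'e) \<Rightarrow> bool" where
  "vector_field M X \<longleftrightarrow>
     (\<forall>c\<in>atlas M. smooth_on (chart_map c ` chart_dom c)
        (\<lambda>x. tangent_coord M c (chart_inv c x) (X (chart_inv c x))))"

definition dir_deriv ::
  "('a, 'e::euclidean_space) manifold \<Rightarrow> 'a \<Rightarrow> 'e \<Rightarrow> ('a \<Rightarrow> real) \<Rightarrow> real" where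
  "dir_deriv M p v f =
     frechet_derivative (f \<circ> chart_inv (chart_at M p)) (at (chart_map (chart_at M p) p)) v"

definition one_form ::
  "('a, 'e::euclidean_space) manifold \<Rightarrow> ('a \<Rightarrow> 'e \<Rightarrow> real) \<Rightarrow> bool" where
  "one_form M \<Phi> \<longleftrightarrow>
     (\<forall>p\<in>points M. linear (\<Phi> p)) \<and>
     (\<forall>X. vector_field M X \<longrightarrow> smooth_fun M (\<lambda>p. \<Phi> p (X p)))"

definition endo_field ::
  "('a, 'e::euclidean_space) manifold \<Rightarrow> ('a \<Rightarrow> 'e \<Rightarrow> 'e) \<Rightarrow> bool" where
  "endo_field M P \<longleftrightarrow>
     (\<forall>p\<in>points M. linear (P p)) \<and>
     (\<forall>X. vector_field M X \<longrightarrow> vector_field M (\<lambda>p. P p (X p)))"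

definition riemannian_metric ::
  "('a, 'e::euclidean_space) manifold \<Rightarrow> ('a \<Rightarrow> 'e \<Rightarrow> 'e \<Rightarrow> real) \<Rightarrow> bool" where
  "riemannian_metric M g \<longleftrightarrow>
     (\<forall>p\<in>points M. bilinear (g p) \<and> (\<forall>v w. g p v w = g p w v) \<and> (\<forall>v. v \<noteq> 0 \<longrightarrow> g p v v > 0)) \<and>
     (\<forall>X Y. vector_field M X \<longrightarrow> vector_field M Y \<longrightarrow> smooth_fun M (\<lambda>p. g p (X p) (Y p)))"

type_synonym ('a, 'e) connection = "('a \<Rightarrow> 'e) \<Rightarrow> ('a \<Rightarrow> 'e) \<Rightarrow> 'a \<Rightarrow> 'e"

definition affine_connection ::
  "('a, 'e::euclidean_space) manifold \<Rightarrow> ('a, 'e) connection \<Rightarrow> bool" where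
  "affine_connection M nabla \<longleftrightarrow>
     (\<forall>X Y. vector_field M X \<longrightarrow> vector_field M Y \<longrightarrow> vector_field M (nabla X Y)) \<and>
     (\<forall>X X' Y. vector_field M X \<longrightarrow> vector_field M X' \<longrightarrow> vector_field M Y \<longrightarrow>
        (\<forall>p\<in>points M. nabla (\<lambda>q. X q + X' q) Y p = nabla X Y p + nabla X' Y p)) \<and>
     (\<forall>f X Y. smooth_fun M f \<longrightarrow> vector_field M X \<longrightarrow> vector_field M Y \<longrightarrow>
        (\<forall>p\<in>points M. nabla (\<lambda>q. f q *\<^sub>R X q) Y p = f p *\<^sub>R nabla X Y p)) \<and>
     (\<forall>X Y Y'. vector_field M X \<longrightarrow> vector_field M Y \<longrightarrow> vector_field M Y' \<longrightarrow>
        (\<forall>p\<in>points M. nabla X (\<lambda>q. Y q + Y' q) p = nabla X Y p + nabla X Y' p)) \<and>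
     (\<forall>f X Y. smooth_fun M f \<longrightarrow> vector_field M X \<longrightarrow> vector_field M Y \<longrightarrow>
        (\<forall>p\<in>points M. nabla X (\<lambda>q. f q *\<^sub>R Y q) p =
           dir_deriv M p (X p) f *\<^sub>R Y p + f p *\<^sub>R nabla X Y p))"

text \<open>The bracket \<open>[X, Y]\<close> enters through its action \<open>X (Y f) - Y (X f)\<close> on functions.\<close>

definition torsion_free ::
  "('a, 'e::euclidean_space) manifold \<Rightarrow> ('a, 'e) connection \<Rightarrow> bool" where
  "torsion_free M nabla \<longleftrightarrow>
     (\<forall>X Y f. vector_field M X \<longrightarrow> vector_field M Y \<longrightarrow> smooth_fun M f \<longrightarrow>
        (\<forall>p\<in>points M. dir_deriv M p (nabla X Y p - nabla Y X p) f =
           dir_deriv M p (X p) (\<lambda>q. dir_deriv M q (Y q) f) -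
           dir_deriv M p (Y p) (\<lambda>q. dir_deriv M q (X q) f)))"

definition metric_compatible ::
  "('a, 'e::euclidean_space) manifold \<Rightarrow> ('a \<Rightarrow> 'e \<Rightarrow> 'e \<Rightarrow> real) \<Rightarrow> ('a, 'e) connection \<Rightarrow> bool"
  where
  "metric_compatible M g nabla \<longleftrightarrow>
     (\<forall>X Y Z. vector_field M X \<longrightarrow> vector_field M Y \<longrightarrow> vector_field M Z \<longrightarrow>
        (\<forall>p\<in>points M. dir_deriv M p (X p) (\<lambda>q. g q (Y q) (Z q)) =
           g p (nabla X Y p) (Z p) + g p (Y p) (nabla X Z p)))"

definition levi_civita ::
  "('a, 'e::euclidean_space) manifold \<Rightarrow> ('a \<Rightarrow> 'e \<Rightarrow> 'e \<Rightarrow> real) \<Rightarrow> ('a, 'e) connection \<Rightarrow> bool"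
  where
  "levi_civita M g nabla \<longleftrightarrow>
     affine_connection M nabla \<and> torsion_free M nabla \<and> metric_compatible M g nabla"

definition open_interval :: "real set \<Rightarrow> bool" where
  "open_interval I \<longleftrightarrow> open I \<and> is_interval I \<and> I \<noteq> {}"

definition smooth_curve ::
  "('a, 'e::euclidean_space) manifold \<Rightarrow> real set \<Rightarrow> (real \<Rightarrow> 'a) \<Rightarrow> bool" where
  "smooth_curve M I \<gamma> \<longleftrightarrow>
     open_interval I \<and> continuous_map (top_of_set I) (mtop M) \<gamma> \<and>
     (\<forall>c\<in>atlas M. smooth_on {t\<in>I. \<gamma> t \<in> chart_dom c} (chart_map c \<circ> \<gamma>))"

text \<open>\<open>X\<close> coincides near \<open>p\<close> with the field whose components in the chart \<open>c\<close> are constantly \<open>u\<close>.\<close>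

definition extends_coord_field ::
  "('a, 'e::euclidean_space) manifold \<Rightarrow> ('a, 'e) chart \<Rightarrow> 'a \<Rightarrow> 'e \<Rightarrow> ('a \<Rightarrow> 'e) \<Rightarrow> bool" where
  "extends_coord_field M c p u X \<longleftrightarrow>
     vector_field M X \<and>
     (\<exists>U. openin (mtop M) U \<and> p \<in> U \<and> U \<subseteq> chart_dom c \<and> (\<forall>q\<in>U. tangent_coord M c q (X q) = u))"

text \<open>The equation of geodesics \<open>x''\<^sup>k + \<Gamma>\<^sup>k\<^sub>i\<^sub>j x'\<^sup>i x'\<^sup>j = 0\<close> in every chart. The Christoffel symbols at
  \<open>p\<close> are the components of \<open>nabla\<close> on global fields which agree with the coordinate fields near
  \<open>p\<close>; such fields exist, and as \<open>nabla\<close> is local their choice does not matter. So the Christoffel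
  term is \<open>nabla X X\<close> for any \<open>X\<close> with constant components \<open>x'(t)\<close> near \<open>\<gamma> t\<close>.\<close>

definition autoparallel ::
  "('a, 'e::euclidean_space) manifold \<Rightarrow> ('a, 'e) connection \<Rightarrow> real set \<Rightarrow> (real \<Rightarrow> 'a) \<Rightarrow> bool"
  where
  "autoparallel M nabla I \<gamma> \<longleftrightarrow>
     smooth_curve M I \<gamma> \<and>
     (\<forall>t\<in>I. \<forall>c\<in>atlas M. \<gamma> t \<in> chart_dom c \<longrightarrow>
        (\<forall>X. extends_coord_field M c (\<gamma> t) (vector_derivative (chart_map c \<circ> \<gamma>) (at t)) X \<longrightarrow>
           vector_derivative (\<lambda>s. vector_derivative (chart_map c \<circ> \<gamma>) (at s)) (at t) +
             tangent_coord M c (\<gamma> t) (nabla X X (\<gamma> t)) = 0))"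

text \<open>On vector fields, and at points of \<open>M\<close>, the Levi-Civita connection of \<open>g\<close> is unique, so the
  existential quantifiers here and in \<open>PQ_projective\<close> just name it.\<close>

definition geodesic ::
  "('a, 'e::euclidean_space) manifold \<Rightarrow> ('a \<Rightarrow> 'e \<Rightarrow> 'e \<Rightarrow> real) \<Rightarrow> real set \<Rightarrow> (real \<Rightarrow> 'a) \<Rightarrow> bool"
  where
  "geodesic M g I \<gamma> \<longleftrightarrow> (\<exists>nabla. levi_civita M g nabla \<and> autoparallel M nabla I \<gamma>)"

definition reparametrization :: "real set \<Rightarrow> real set \<Rightarrow> (real \<Rightarrow> real) \<Rightarrow> bool" where
  "reparametrization J I \<tau> \<longleftrightarrow>
     open_interval J \<and> bij_betw \<tau> J I \<and> smooth_on J \<tau> \<and> (\<forall>t\<in>J. deriv \<tau> t \<noteq> 0)"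

definition unparametrized_geodesic ::
  "('a, 'e::euclidean_space) manifold \<Rightarrow> ('a \<Rightarrow> 'e \<Rightarrow> 'e \<Rightarrow> real) \<Rightarrow> real set \<Rightarrow> (real \<Rightarrow> 'a) \<Rightarrow> bool"
  where
  "unparametrized_geodesic M g I \<gamma> \<longleftrightarrow>
     (\<exists>J \<tau>. reparametrization J I \<tau> \<and> geodesic M g J (\<gamma> \<circ> \<tau>))"

definition projectively_equivalent ::
  "('a, 'e::euclidean_space) manifold \<Rightarrow> ('a \<Rightarrow> 'e \<Rightarrow> 'e \<Rightarrow> real) \<Rightarrow> ('a \<Rightarrow> 'e \<Rightarrow> 'e \<Rightarrow> real) \<Rightarrow> bool"
  where
  "projectively_equivalent M g gbar \<longleftrightarrow>
     (\<forall>I \<gamma>. open_interval I \<longrightarrow>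
        (unparametrized_geodesic M g I \<gamma> \<longleftrightarrow> unparametrized_geodesic M gbar I \<gamma>))"

definition skew_wrt ::
  "('a, 'e::euclidean_space) manifold \<Rightarrow> ('a \<Rightarrow> 'e \<Rightarrow> 'e \<Rightarrow> real) \<Rightarrow> ('a \<Rightarrow> 'e \<Rightarrow> 'e) \<Rightarrow> bool" where
  "skew_wrt M g P \<longleftrightarrow> (\<forall>p\<in>points M. \<forall>v w. g p (P p v) w = - g p v (P p w))"

definition PQ_compatible ::
  "('a, 'e::euclidean_space) manifold \<Rightarrow> ('a \<Rightarrow> 'e \<Rightarrow> 'e) \<Rightarrow> ('a \<Rightarrow> 'e \<Rightarrow> 'e) \<Rightarrow> real \<Rightarrow>
   ('a \<Rightarrow> 'e \<Rightarrow> 'e \<Rightarrow> real) \<Rightarrow> ('a \<Rightarrow> 'e \<Rightarrow> 'e \<Rightarrow> real) \<Rightarrow> bool" where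
  "PQ_compatible M P Q \<epsilon> g gbar \<longleftrightarrow>
     skew_wrt M g P \<and> skew_wrt M g Q \<and> skew_wrt M gbar P \<and> skew_wrt M gbar Q \<and>
     (\<forall>p\<in>points M. \<forall>v. P p (Q p v) = \<epsilon> *\<^sub>R v)"

definition PQ_projective ::
  "('a, 'e::euclidean_space) manifold \<Rightarrow> ('a \<Rightarrow> 'e \<Rightarrow> 'e) \<Rightarrow> ('a \<Rightarrow> 'e \<Rightarrow> 'e) \<Rightarrow>
   ('a \<Rightarrow> 'e \<Rightarrow> 'e \<Rightarrow> real) \<Rightarrow> ('a \<Rightarrow> 'e \<Rightarrow> 'e \<Rightarrow> real) \<Rightarrow> bool" where
  "PQ_projective M P Q g gbar \<longleftrightarrow>
     (\<exists>nabla nablabar \<Phi>.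
        levi_civita M g nabla \<and> levi_civita M gbar nablabar \<and> one_form M \<Phi> \<and>
        (\<forall>X Y. vector_field M X \<longrightarrow> vector_field M Y \<longrightarrow>
           (\<forall>p\<in>points M. nablabar X Y p - nabla X Y p =
              \<Phi> p (X p) *\<^sub>R Y p + \<Phi> p (Y p) *\<^sub>R X p
              - \<Phi> p (P p (X p)) *\<^sub>R Q p (Y p) - \<Phi> p (P p (Y p)) *\<^sub>R Q p (X p))))"

end

theory Submission
  imports Defs
begin

text \<open>Let \<open>D = nablabar - nabla\<close>. For \<open>\<epsilon> = 0\<close> the products \<open>P Q\<close> and \<open>Q P\<close> vanish, the second being the
  adjoint of the first, as both tensors are skew. The claim follows from \<open>\<Phi> \<circ> P = 0\<close>, since then
  \<open>D X X = 2 \<Phi>(X) X\<close> and the two equations of geodesics differ by a multiple of the velocity.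

  The identity \<open>\<Phi> \<circ> P = 0\<close> (\<open>one_form_P_zero\<close>) is pointwise. Evaluate it on an eigenvector \<open>x\<close> of \<open>gbar\<close>
  relative to \<open>g\<close> with eigenvalue \<open>\<mu>\<close>; these span the tangent space (\<open>span_relative_eigenvectors\<close>). For a
  field \<open>X\<close> through \<open>x\<close> both \<open>g (P X) X\<close> and \<open>gbar (P X) X\<close> vanish identically. Differentiate them along
  \<open>X\<close>, using that each connection preserves its metric, and subtract \<open>\<mu>\<close> times the first result from the
  second. As \<open>x\<close> and \<open>P x\<close> are eigenvectors for the same \<open>\<mu>\<close>, every derivative of \<open>P\<close> and \<open>X\<close> cancels, and
  what is left is \<open>\<Phi>(P x) gbar x x = 0\<close>.

  To pass from connections to geodesics (\<open>autoparallel_reparametrize\<close>), a geodesic \<open>\<sigma>\<close> of \<open>g\<close> is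
  reparametrized by a solution of \<open>\<theta>'' = - 2 \<Phi>(\<sigma>')(\<theta>) \<theta>'\<^sup>2\<close>, whose inverse is obtained by two quadratures.
  The converse direction is the same with \<open>-\<Phi>\<close>. Geodesics are defined by means of some Levi-Civita
  connection, whence the need for its uniqueness (\<open>levi_civita_unique\<close>).

  The geometric objects are tested on global smooth fields, so a supply of those is required: bump
  functions in charts provide fields through any tangent vector, functions separating tangent vectors,
  and local frames exhibiting the components of \<open>\<Phi>\<close> as smooth functions. Their smoothness rests on
  closure properties of the classes \<open>C\<^sup>k\<close> under products, composition and extension by zero.\<close>

section \<open>Calculus of functions of class \<open>C\<^sup>k\<close> on open sets\<close>

lemma Ck_on_cong_imp:
  assumes "open S" "\<And>x. x \<in> S \<Longrightarrow> f x = g x" "Ck_on k S f"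
  shows "Ck_on k S g"
  using assms(2,3)
proof (induction k arbitrary: f g)
  case 0
  then show ?case by (simp cong: continuous_on_cong)
next
  case (Suc k)
  have "g differentiable at x" if "x \<in> S" for x
    using Suc.prems that assms(1) has_derivative_transform_within_open
    unfolding differentiable_def Ck_on.simps by blast
  moreover have "frechet_derivative f (at x) v = frechet_derivative g (at x) v" if "x \<in> S" for x v
    using frechet_derivative_transform_within_open[of f x S g] Suc.prems that assms(1) by auto
  then have "Ck_on k S (\<lambda>x. frechet_derivative g (at x) v)" for v
    using Suc.IH[of "\<lambda>x. frechet_derivative f (at x) v" "\<lambda>x. frechet_derivative g (at x) v"] Suc.prems
    by auto
  ultimately show ?case by simp
qed

lemma Ck_on_cong:
  assumes "open S" "\<And>x. x \<in> S \<Longrightarrow> f x = g x"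
  shows "Ck_on k S f \<longleftrightarrow> Ck_on k S g"
  using Ck_on_cong_imp[OF assms(1), of f g k] Ck_on_cong_imp[OF assms(1), of g f k] assms(2) by auto

lemma Ck_on_SucI:
  assumes "open S" "\<And>x. x \<in> S \<Longrightarrow> (f has_derivative f' x) (at x)" "\<And>v. Ck_on k S (\<lambda>x. f' x v)"
  shows "Ck_on (Suc k) S f"
proof -
  have "Ck_on k S (\<lambda>x. frechet_derivative f (at x) v)" for v
    by (rule Ck_on_cong_imp[OF assms(1) _ assms(3)[of v]])
      (use frechet_derivative_at[OF assms(2)] in auto)
  then show ?thesis using assms(2) by (auto simp: differentiable_def)
qed

lemma Ck_on_Suc_has_derivative:
  "Ck_on (Suc k) S f \<Longrightarrow> x \<in> S \<Longrightarrow> (f has_derivative frechet_derivative f (at x)) (at x)"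
  by (simp add: frechet_derivative_works[symmetric])

lemma Ck_on_subset: "Ck_on k S f \<Longrightarrow> T \<subseteq> S \<Longrightarrow> Ck_on k T f"
  by (induction k arbitrary: f) (auto intro: continuous_on_subset)

lemma Ck_on_local:
  assumes "\<And>x. x \<in> S \<Longrightarrow> \<exists>U. open U \<and> x \<in> U \<and> Ck_on k (U \<inter> S) f" "open S"
  shows "Ck_on k S f"
  using assms(1)
proof (induction k arbitrary: f)
  case 0
  have "isCont f x" if x: "x \<in> S" for x
  proof -
    obtain U where "open U" "x \<in> U" "continuous_on (U \<inter> S) f" using 0[OF x] by auto
    then show ?thesis using assms(2) x continuous_on_eq_continuous_at[of "U \<inter> S" f] by auto
  qed
  then show ?case by (simp add: continuous_at_imp_continuous_on)
next
  case (Suc k)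
  have "f differentiable at x" if "x \<in> S" for x
    using Suc.prems[OF that] that by auto
  moreover have "Ck_on k S (\<lambda>x. frechet_derivative f (at x) v)" for v
    by (rule Suc.IH) (use Suc.prems in fastforce)
  ultimately show ?case by simp
qed

lemma Ck_on_Suc_imp: "Ck_on (Suc k) S f \<Longrightarrow> Ck_on k S f"
proof (induction k arbitrary: f)
  case 0
  then show ?case
    by (auto intro!: continuous_at_imp_continuous_on differentiable_imp_continuous_within)
next
  case (Suc k)
  then show ?case by (metis Ck_on.simps(2))
qed

lemma Ck_on_imp_continuous_on: "Ck_on k S f \<Longrightarrow> continuous_on S f"
  by (induction k) (simp_all add: Ck_on_Suc_imp del: Ck_on.simps(2))

lemma Ck_on_const: "open S \<Longrightarrow> Ck_on k S (\<lambda>x. c)"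
proof (induction k arbitrary: c)
  case (Suc k)
  then show ?case by (auto intro!: Ck_on_SucI[where f' = "\<lambda>x v. 0"])
qed simp

lemma Ck_on_bounded_linear_comp:
  assumes "bounded_linear L" "open S" "Ck_on k S f"
  shows "Ck_on k S (\<lambda>x. L (f x))"
  using assms(3)
proof (induction k arbitrary: f)
  case 0
  then show ?case using assms(1) by (simp add: bounded_linear.continuous_on)
next
  case (Suc k)
  show ?case
    by (rule Ck_on_SucI[OF assms(2), where f' = "\<lambda>x v. L (frechet_derivative f (at x) v)"])
      (use Suc in \<open>auto intro!: bounded_linear.has_derivative[OF assms(1)]
        simp: frechet_derivative_works[symmetric]\<close>)
qed

lemma Ck_on_ident: "open S \<Longrightarrow> Ck_on k S (\<lambda>x. x)"
proof (cases k)
  case (Suc j)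
  assume "open S"
  then show ?thesis unfolding Suc
    by (intro Ck_on_SucI[where f' = "\<lambda>x v. v"] Ck_on_const) auto
qed simp

lemma Ck_on_add:
  assumes "open S" "Ck_on k S f" "Ck_on k S g"
  shows "Ck_on k S (\<lambda>x. f x + g x)"
  using assms(2,3)
proof (induction k arbitrary: f g)
  case (Suc k)
  show ?case
    by (rule Ck_on_SucI[OF assms(1),
          where f' = "\<lambda>x v. frechet_derivative f (at x) v + frechet_derivative g (at x) v"])
      (use Suc in \<open>auto intro!: has_derivative_add simp: frechet_derivative_works[symmetric]\<close>)
qed (auto intro: continuous_intros)

lemma Ck_on_sum:
  assumes "open S" "\<And>i. i \<in> A \<Longrightarrow> Ck_on k S (f i)"
  shows "Ck_on k S (\<lambda>x. \<Sum>i\<in>A. f i x)"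
  using assms(2)
  by (induction A rule: infinite_finite_induct) (auto intro!: Ck_on_const Ck_on_add assms(1))

lemma Ck_on_bounded_bilinear:
  assumes "bounded_bilinear B" "open S" "Ck_on k S f" "Ck_on k S g"
  shows "Ck_on k S (\<lambda>x. B (f x) (g x))"
  using assms(3,4)
proof (induction k arbitrary: f g)
  case 0
  then show ?case by (simp add: bounded_bilinear.continuous_on[OF assms(1)])
next
  case (Suc k)
  show ?case
    by (rule Ck_on_SucI[OF assms(2), where f' = "\<lambda>x v. B (f x) (frechet_derivative g (at x) v) +
         B (frechet_derivative f (at x) v) (g x)"])
      (use Suc.prems Suc.prems[THEN Ck_on_Suc_imp] in \<open>auto intro!: Ck_on_add assms(2) Suc.IH
        bounded_bilinear.FDERIV[OF assms(1)] simp: frechet_derivative_works[symmetric]\<close>)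
qed

text \<open>By the chain rule the directional derivatives of \<open>g \<circ> f\<close> are finite sums of products of
  those of \<open>f\<close> with functions \<open>h \<circ> f\<close>, where \<open>h\<close> is a partial derivative of \<open>g\<close>; finite dimension
  of the intermediate space is what makes directional derivatives suffice.\<close>

lemma Ck_on_compose:
  fixes f :: "'a::euclidean_space \<Rightarrow> 'b::euclidean_space"
    and g :: "'b \<Rightarrow> 'c::real_normed_vector"
  assumes "open S" "Ck_on k S f" "Ck_on k T g" "f ` S \<subseteq> T"
  shows "Ck_on k S (\<lambda>x. g (f x))"
  using assms(2,3)
proof (induction k arbitrary: g)
  case 0
  then show ?case using assms(4) by (auto intro: continuous_on_compose2)
next
  case (Suc k)
  have eq: "frechet_derivative g (at (f x)) w =
      (\<Sum>b\<in>Basis. (w \<bullet> b) *\<^sub>R frechet_derivative g (at (f x)) b)" if "x \<in> S" for x w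
  proof -
    have "linear (frechet_derivative g (at (f x)))"
      using Suc.prems assms(4) that by (auto intro!: linear_frechet_derivative)
    from linear_sum[OF this, of "\<lambda>b. (w \<bullet> b) *\<^sub>R b" Basis] show ?thesis
      by (simp add: euclidean_representation linear_scale[OF \<open>linear _\<close>])
  qed
  show ?case
  proof (rule Ck_on_SucI[OF assms(1), where f' = "\<lambda>x v. \<Sum>b\<in>Basis.
       (frechet_derivative f (at x) v \<bullet> b) *\<^sub>R frechet_derivative g (at (f x)) b"])
    fix x assume "x \<in> S"
    then have "(f has_derivative frechet_derivative f (at x)) (at x)"
      "(g has_derivative frechet_derivative g (at (f x))) (at (f x))"
      using Suc.prems assms(4) by (auto simp: frechet_derivative_works[symmetric])
    from diff_chain_at[OF this]
    have "((\<lambda>x. g (f x)) has_derivative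
        (\<lambda>v. frechet_derivative g (at (f x)) (frechet_derivative f (at x) v))) (at x)"
      by (simp add: o_def)
    then show "((\<lambda>x. g (f x)) has_derivative (\<lambda>v. \<Sum>b\<in>Basis.
       (frechet_derivative f (at x) v \<bullet> b) *\<^sub>R frechet_derivative g (at (f x)) b)) (at x)"
      by (subst (asm) eq[OF \<open>x \<in> S\<close>])
  next
    fix v
    show "Ck_on k S (\<lambda>x. \<Sum>b\<in>Basis.
       (frechet_derivative f (at x) v \<bullet> b) *\<^sub>R frechet_derivative g (at (f x)) b)"
      using Suc.prems Ck_on_Suc_imp[OF Suc.prems(1)]
      by (intro Ck_on_sum assms(1) Ck_on_bounded_bilinear[OF bounded_bilinear_scaleR]
          Ck_on_bounded_linear_comp[OF bounded_linear_inner_left] Suc.IH) auto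
  qed
qed

lemma Ck_on_inverse: "Ck_on k (- {0}) (inverse :: real \<Rightarrow> real)"
proof (induction k)
  case (Suc k)
  show ?case
    by (rule Ck_on_SucI[where f' = "\<lambda>x v. v * (- (inverse x * inverse x))"])
      (auto intro!: derivative_eq_intros
         Ck_on_bounded_linear_comp[OF bounded_linear_mult_right]
         Ck_on_bounded_linear_comp[OF bounded_linear_minus[OF bounded_linear_ident]]
         Ck_on_bounded_bilinear[OF bounded_bilinear_mult] Suc)
qed (auto intro: continuous_intros)

lemma Ck_on_exp: "Ck_on k UNIV (exp :: real \<Rightarrow> real)"
proof (induction k)
  case (Suc k)
  show ?case
    by (rule Ck_on_SucI[where f' = "\<lambda>x v. v * exp x"])
      (auto intro!: derivative_eq_intros Ck_on_bounded_linear_comp[OF bounded_linear_mult_right] Suc)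
qed (auto intro: continuous_intros)

lemma smooth_onD: "smooth_on S f \<Longrightarrow> Ck_on k S f"
  by (simp add: smooth_on_def)

lemma smooth_on_cong:
  "open S \<Longrightarrow> (\<And>x. x \<in> S \<Longrightarrow> f x = g x) \<Longrightarrow> smooth_on S f \<longleftrightarrow> smooth_on S g"
  using Ck_on_cong[of S f g] by (simp add: smooth_on_def)

lemma smooth_on_subset: "smooth_on S f \<Longrightarrow> T \<subseteq> S \<Longrightarrow> smooth_on T f"
  by (auto simp: smooth_on_def intro: Ck_on_subset)

lemma smooth_on_local:
  assumes "\<And>x. x \<in> S \<Longrightarrow> \<exists>U. open U \<and> x \<in> U \<and> smooth_on (U \<inter> S) f" "open S"
  shows "smooth_on S f"
  unfolding smooth_on_def using assms by (metis Ck_on_local smooth_on_def)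

lemma smooth_on_const: "open S \<Longrightarrow> smooth_on S (\<lambda>x. c)"
  by (simp add: smooth_on_def Ck_on_const)

lemma smooth_on_ident: "open S \<Longrightarrow> smooth_on S (\<lambda>x. x)"
  by (simp add: smooth_on_def Ck_on_ident)

lemma smooth_on_bounded_linear_comp:
  "bounded_linear L \<Longrightarrow> open S \<Longrightarrow> smooth_on S f \<Longrightarrow> smooth_on S (\<lambda>x. L (f x))"
  by (simp add: smooth_on_def Ck_on_bounded_linear_comp)

lemma smooth_on_add:
  "open S \<Longrightarrow> smooth_on S f \<Longrightarrow> smooth_on S g \<Longrightarrow> smooth_on S (\<lambda>x. f x + g x)"
  by (simp add: smooth_on_def Ck_on_add)

lemma smooth_on_diff:
  assumes "open S" "smooth_on S f" "smooth_on S g"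
  shows "smooth_on S (\<lambda>x. f x - g x)"
  using smooth_on_add[OF assms(1,2)
      smooth_on_bounded_linear_comp[OF bounded_linear_minus[OF bounded_linear_ident] assms(1,3)]]
  by simp

lemma smooth_on_sum:
  "open S \<Longrightarrow> (\<And>i. i \<in> A \<Longrightarrow> smooth_on S (f i)) \<Longrightarrow> smooth_on S (\<lambda>x. \<Sum>i\<in>A. f i x)"
  by (simp add: smooth_on_def Ck_on_sum)

lemma smooth_on_bounded_bilinear:
  "bounded_bilinear B \<Longrightarrow> open S \<Longrightarrow> smooth_on S f \<Longrightarrow> smooth_on S g \<Longrightarrow>
    smooth_on S (\<lambda>x. B (f x) (g x))"
  by (simp add: smooth_on_def Ck_on_bounded_bilinear)

lemmas smooth_on_scaleR = smooth_on_bounded_bilinear[OF bounded_bilinear_scaleR]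
  and smooth_on_mult = smooth_on_bounded_bilinear[OF bounded_bilinear_mult]
  and smooth_on_inner = smooth_on_bounded_bilinear[OF bounded_bilinear_inner]

lemma smooth_on_compose:
  fixes f :: "'a::euclidean_space \<Rightarrow> 'b::euclidean_space"
  shows "open S \<Longrightarrow> smooth_on S f \<Longrightarrow> smooth_on T g \<Longrightarrow> f ` S \<subseteq> T \<Longrightarrow> smooth_on S (\<lambda>x. g (f x))"
  by (auto simp: smooth_on_def intro: Ck_on_compose)

lemma smooth_on_inverse:
  "open S \<Longrightarrow> smooth_on S f \<Longrightarrow> (\<And>x. x \<in> S \<Longrightarrow> f x \<noteq> 0) \<Longrightarrow> smooth_on S (\<lambda>x. inverse (f x :: real))"
  by (rule smooth_on_compose[where T = "- {0}"]) (auto simp: smooth_on_def Ck_on_inverse)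

lemma smooth_on_exp: "open S \<Longrightarrow> smooth_on S f \<Longrightarrow> smooth_on S (\<lambda>x. exp (f x :: real))"
  by (rule smooth_on_compose[where T = UNIV]) (auto simp: smooth_on_def Ck_on_exp)

lemma smooth_on_has_derivative:
  "smooth_on S f \<Longrightarrow> x \<in> S \<Longrightarrow> (f has_derivative frechet_derivative f (at x)) (at x)"
  using Ck_on_Suc_has_derivative[of 0 S f] by (auto simp: smooth_on_def simp del: Ck_on.simps)

lemma smooth_on_differentiable: "smooth_on S f \<Longrightarrow> x \<in> S \<Longrightarrow> f differentiable at x"
  using smooth_on_has_derivative differentiable_def by blast

lemma smooth_on_frechet_derivative:
  "smooth_on S f \<Longrightarrow> smooth_on S (\<lambda>x. frechet_derivative f (at x) v)"
  unfolding smooth_on_def by (metis Ck_on.simps(2))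

lemma smooth_on_imp_continuous_on: "smooth_on S f \<Longrightarrow> continuous_on S f"
  using Ck_on_imp_continuous_on smooth_onD by blast

lemma smooth_on_has_vector_derivative:
  fixes x :: "real \<Rightarrow> 'b::real_normed_vector"
  assumes "smooth_on S x" "t \<in> S"
  shows "(x has_vector_derivative vector_derivative x (at t)) (at t)"
  using smooth_on_differentiable[OF assms] vector_derivative_works by blast

lemma smooth_on_vector_derivative:
  fixes x :: "real \<Rightarrow> 'b::real_normed_vector"
  assumes "open S" "smooth_on S x"
  shows "smooth_on S (\<lambda>t. vector_derivative x (at t))"
proof (rule smooth_on_cong[THEN iffD1, OF assms(1) _ smooth_on_frechet_derivative[OF assms(2), of 1]])
  show "frechet_derivative x (at t) 1 = vector_derivative x (at t)" if "t \<in> S" for t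
    using smooth_on_differentiable[OF assms(2) that] by (simp add: frechet_derivative_eq_vector_derivative)
qed

text \<open>The class of functions vanishing for \<open>x \<le> 0\<close> and of the form \<open>p (1 / x) exp (- 1 / x)\<close> with a
  polynomial \<open>p\<close> for \<open>x > 0\<close> is closed under differentiation: \<open>p\<close> becomes \<open>X\<^sup>2 (p - p')\<close>.\<close>

definition flat_fun :: "real poly \<Rightarrow> real \<Rightarrow> real" where
  "flat_fun p x = (if x > 0 then poly p (inverse x) * exp (- inverse x) else 0)"

lemma poly_div_exp_at_top: "((\<lambda>y. poly p y / exp y) \<longlongrightarrow> (0::real)) at_top"
proof -
  have "((\<lambda>y. \<Sum>i\<le>degree p. coeff p i * (y ^ i / exp y)) \<longlongrightarrow> (\<Sum>i\<le>degree p. coeff p i * 0)) at_top"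
    by (intro tendsto_intros tendsto_power_div_exp_0)
  then show ?thesis by (simp add: poly_altdef sum_divide_distrib)
qed

lemma flat_fun_has_derivative:
  "(flat_fun p has_real_derivative flat_fun ([:0, 0, 1:] * (p - pderiv p)) x) (at x)"
proof (cases x "0::real" rule: linorder_cases)
  case less
  have "((\<lambda>x. 0) has_real_derivative 0) (at x)" by simp
  then have "(flat_fun p has_real_derivative 0) (at x)"
    by (rule has_field_derivative_transform_within_open[where S = "{..<0}"])
      (use less in \<open>auto simp: flat_fun_def\<close>)
  then show ?thesis using less by (simp add: flat_fun_def)
next
  case greater
  have "((\<lambda>x. poly p (inverse x) * exp (- inverse x)) has_real_derivative
      flat_fun ([:0, 0, 1:] * (p - pderiv p)) x) (at x)"
    using greater by (auto simp: flat_fun_def algebra_simps power2_eq_square field_simps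
        intro!: derivative_eq_intros poly_DERIV[THEN DERIV_chain2])
  then show ?thesis
    by (rule has_field_derivative_transform_within_open[where S = "{0<..}"])
      (use greater in \<open>auto simp: flat_fun_def\<close>)
next
  case equal
  have right: "((\<lambda>h. flat_fun p h / h) \<longlongrightarrow> 0) (at_right 0)"
  proof (rule Lim_transform_eventually)
    show "((\<lambda>h. poly ([:0, 1:] * p) (inverse h) / exp (inverse h)) \<longlongrightarrow> 0) (at_right (0::real))"
      by (rule filterlim_compose[OF poly_div_exp_at_top filterlim_inverse_at_top_right])
    show "\<forall>\<^sub>F h in at_right 0. poly ([:0, 1:] * p) (inverse h) / exp (inverse h) = flat_fun p h / h"
      by (auto simp: eventually_at_filter flat_fun_def exp_minus field_simps intro!: always_eventually)
  qed
  have left: "((\<lambda>h. flat_fun p h / h) \<longlongrightarrow> 0) (at_left 0)"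
    by (rule tendsto_eventually) (auto simp: eventually_at_filter flat_fun_def intro!: always_eventually)
  from left right have "((\<lambda>h. flat_fun p h / h) \<longlongrightarrow> 0) (at 0)"
    by (rule filterlim_split_at)
  then show ?thesis
    unfolding equal DERIV_def by (simp add: flat_fun_def)
qed

lemma Ck_on_flat_fun: "Ck_on k UNIV (flat_fun p)"
proof (induction k arbitrary: p)
  case 0
  show ?case
    using DERIV_isCont[OF flat_fun_has_derivative] by (simp add: continuous_on_eq_continuous_at)
next
  case (Suc k)
  show ?case
    by (rule Ck_on_SucI[where f' = "\<lambda>x v. flat_fun ([:0, 0, 1:] * (p - pderiv p)) x * v"])
      (use flat_fun_has_derivative[unfolded has_field_derivative_def] in
        \<open>auto intro!: Suc Ck_on_bounded_linear_comp[OF bounded_linear_mult_left]\<close>)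
qed

text \<open>With the polynomial \<open>1\<close> this is \<open>exp (- 1 / (r\<^sup>2 - \<bar>x - a\<bar>\<^sup>2))\<close> inside the ball. Bumps that are merely
  positive there, rather than \<open>1\<close> near the centre, suffice, as one can divide by them locally.\<close>

definition bump :: "'e::euclidean_space \<Rightarrow> real \<Rightarrow> 'e \<Rightarrow> real" where
  "bump a r x = flat_fun 1 (r\<^sup>2 - (x - a) \<bullet> (x - a))"

lemma smooth_on_bump: "open S \<Longrightarrow> smooth_on S (bump a r)"
  unfolding bump_def[abs_def]
  by (rule smooth_on_compose[where T = UNIV])
    (auto simp: smooth_on_def[of UNIV] Ck_on_flat_fun
      intro!: smooth_on_diff smooth_on_const smooth_on_inner smooth_on_ident)

lemma bump_eq_0:
  assumes "r > 0" "x \<notin> ball a r"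
  shows "bump a r x = 0"
proof -
  have "r\<^sup>2 \<le> (norm (x - a))\<^sup>2"
    using assms by (intro power_mono) (auto simp: dist_norm norm_minus_commute)
  then show ?thesis by (simp add: bump_def flat_fun_def power2_norm_eq_inner)
qed

lemma bump_pos: "x \<in> ball a r \<Longrightarrow> bump a r x > 0"
  using power_strict_mono[of "norm (x - a)" r 2]
  by (auto simp: bump_def flat_fun_def power2_norm_eq_inner[symmetric] dist_norm norm_minus_commute)

section \<open>Charts and bump fields\<close>

text \<open>The differential at \<open>q\<close> of the change from the coordinates \<open>c\<close> to the coordinates \<open>d\<close>.\<close>

definition transition_deriv ::
  "('a, 'e::euclidean_space) chart \<Rightarrow> ('a, 'e) chart \<Rightarrow> 'a \<Rightarrow> 'e \<Rightarrow> 'e" where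
  "transition_deriv c d q =
     frechet_derivative (chart_map d \<circ> chart_inv c) (at (chart_map c q))"

abbreviation chart_range :: "('a, 'e) chart \<Rightarrow> 'e set" where
  "chart_range c \<equiv> chart_map c ` chart_dom c"

lemma tangent_coord_eq: "tangent_coord M c q v = transition_deriv (chart_at M q) c q v"
  by (simp add: tangent_coord_def transition_deriv_def)

locale smooth_mfd =
  fixes M :: "('a, 'e::euclidean_space) manifold"
  assumes smooth_manifold: "smooth_manifold M"
begin

lemma is_chart: "c \<in> atlas M \<Longrightarrow> is_chart (mtop M) c"
  using smooth_manifold by (simp add: smooth_manifold_def)

lemma Union_chart_dom: "(\<Union>c\<in>atlas M. chart_dom c) = points M"
  using smooth_manifold by (simp add: smooth_manifold_def)

lemma Hausdorff_space: "Hausdorff_space (mtop M)"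
  using smooth_manifold by (simp add: smooth_manifold_def)

lemma openin_chart_dom: "c \<in> atlas M \<Longrightarrow> openin (mtop M) (chart_dom c)"
  using is_chart by (simp add: is_chart_def)

lemma chart_dom_subset: "c \<in> atlas M \<Longrightarrow> chart_dom c \<subseteq> points M"
  using openin_chart_dom openin_subset by blast

lemma open_chart_range: "c \<in> atlas M \<Longrightarrow> open (chart_range c)"
  using is_chart by (simp add: is_chart_def)

lemma homeomorphic_chart:
  "c \<in> atlas M \<Longrightarrow>
    homeomorphic_map (subtopology (mtop M) (chart_dom c)) (top_of_set (chart_range c)) (chart_map c)"
  using is_chart by (simp add: is_chart_def)

lemma topspace_chart_dom: "c \<in> atlas M \<Longrightarrow> topspace (subtopology (mtop M) (chart_dom c)) = chart_dom c"
  using chart_dom_subset by (simp add: topspace_subtopology inf.absorb2)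

lemma inj_on_chart: "c \<in> atlas M \<Longrightarrow> inj_on (chart_map c) (chart_dom c)"
  using homeomorphic_imp_injective_map[OF homeomorphic_chart] topspace_chart_dom by metis

lemma chart_inv_chart: "c \<in> atlas M \<Longrightarrow> q \<in> chart_dom c \<Longrightarrow> chart_inv c (chart_map c q) = q"
  by (simp add: chart_inv_def inv_into_f_f inj_on_chart)

lemma chart_inv_in: "x \<in> chart_range c \<Longrightarrow> chart_inv c x \<in> chart_dom c"
  by (simp add: chart_inv_def inv_into_into)

lemma open_chart_image:
  assumes "c \<in> atlas M" "openin (mtop M) U" "U \<subseteq> chart_dom c"
  shows "open (chart_map c ` U)"
proof -
  have "openin (subtopology (mtop M) (chart_dom c)) U"
    using assms by (simp add: openin_subset_topspace_eq openin_open_subtopology openin_chart_dom)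
  then have "openin (top_of_set (chart_range c)) (chart_map c ` U)"
    using homeomorphic_imp_open_map[OF homeomorphic_chart[OF assms(1)]] by (simp add: open_map_def)
  then show ?thesis using open_chart_range[OF assms(1)] openin_open_trans by blast
qed

lemma open_overlap:
  assumes "c \<in> atlas M" "d \<in> atlas M"
  shows "open (chart_map c ` (chart_dom c \<inter> chart_dom d))"
  using assms by (intro open_chart_image) (auto intro: openin_chart_dom)

text \<open>Compactness in the chart gives closedness in all of \<open>M\<close> by the Hausdorff property.\<close>

lemma closedin_chart_inv_compact:
  assumes "c \<in> atlas M" "compact K" "K \<subseteq> chart_range c"
  shows "closedin (mtop M) (chart_inv c ` K)"
proof -
  obtain g where g: "homeomorphic_maps (subtopology (mtop M) (chart_dom c)) (top_of_set (chart_range c))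
      (chart_map c) g"
    using homeomorphic_chart[OF assms(1)] homeomorphic_map_maps by blast
  have "chart_inv c x = g x" if "x \<in> chart_range c" for x
  proof -
    have "g x \<in> chart_dom c" "chart_map c (g x) = x"
      using g that topspace_chart_dom[OF assms(1)]
      by (auto simp: homeomorphic_maps_def continuous_map_def)
    then show ?thesis using chart_inv_chart[OF assms(1), of "g x"] by simp
  qed
  then have eq: "chart_inv c ` K = g ` K"
    using assms(3) by (auto intro!: image_cong)
  have "compactin (top_of_set (chart_range c)) K"
    using assms by (simp add: compactin_subtopology)
  then have "compactin (subtopology (mtop M) (chart_dom c)) (g ` K)"
    using g by (auto simp: homeomorphic_maps_def intro: image_compactin)
  then have "compactin (mtop M) (chart_inv c ` K)"
    by (simp add: compactin_subtopology eq)
  then show ?thesis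
    using Hausdorff_space compactin_imp_closedin by blast
qed

lemma smooth_on_transition:
  "c \<in> atlas M \<Longrightarrow> d \<in> atlas M \<Longrightarrow>
    smooth_on (chart_map c ` (chart_dom c \<inter> chart_dom d)) (chart_map d \<circ> chart_inv c)"
  using smooth_manifold by (simp add: smooth_manifold_def)

lemma transition_has_derivative:
  assumes "c \<in> atlas M" "d \<in> atlas M" "q \<in> chart_dom c" "q \<in> chart_dom d"
  shows "((chart_map d \<circ> chart_inv c) has_derivative transition_deriv c d q) (at (chart_map c q))"
  unfolding transition_deriv_def
  by (rule smooth_on_has_derivative[OF smooth_on_transition]) (use assms in auto)

lemma linear_transition_deriv:
  "c \<in> atlas M \<Longrightarrow> d \<in> atlas M \<Longrightarrow> q \<in> chart_dom c \<Longrightarrow> q \<in> chart_dom d \<Longrightarrow>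
    linear (transition_deriv c d q)"
  using transition_has_derivative has_derivative_linear by blast

lemma transition_deriv_trans:
  assumes "c \<in> atlas M" "d \<in> atlas M" "e \<in> atlas M"
    and q: "q \<in> chart_dom c" "q \<in> chart_dom d" "q \<in> chart_dom e"
  shows "transition_deriv d e q (transition_deriv c d q v) = transition_deriv c e q v"
proof -
  have "((chart_map d \<circ> chart_inv c) has_derivative transition_deriv c d q) (at (chart_map c q))"
    by (rule transition_has_derivative) (use assms in auto)
  moreover have "((chart_map e \<circ> chart_inv d) has_derivative transition_deriv d e q)
      (at ((chart_map d \<circ> chart_inv c) (chart_map c q)))"
    using transition_has_derivative[of d e q] assms by (simp add: chart_inv_chart)
  ultimately have "((chart_map e \<circ> chart_inv d) \<circ> (chart_map d \<circ> chart_inv c) has_derivative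
      transition_deriv d e q \<circ> transition_deriv c d q) (at (chart_map c q))"
    by (rule diff_chain_at)
  then have "((chart_map e \<circ> chart_inv c) has_derivative
      transition_deriv d e q \<circ> transition_deriv c d q) (at (chart_map c q))"
    by (rule has_derivative_transform_within_open[OF _ open_overlap[OF assms(1,2)]])
      (use assms in \<open>auto simp: chart_inv_chart\<close>)
  then show ?thesis
    using has_derivative_unique transition_has_derivative assms by (metis comp_apply)
qed

lemma transition_deriv_refl:
  assumes "c \<in> atlas M" "q \<in> chart_dom c"
  shows "transition_deriv c c q v = v"
proof -
  have "((\<lambda>x. x) has_derivative (\<lambda>v. v)) (at (chart_map c q))" by simp
  then have "((chart_map c \<circ> chart_inv c) has_derivative (\<lambda>v. v)) (at (chart_map c q))"
    by (rule has_derivative_transform_within_open[OF _ open_chart_range[OF assms(1)]])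
      (use assms in \<open>auto simp: chart_inv_chart\<close>)
  then show ?thesis
    using has_derivative_unique transition_has_derivative assms by metis
qed

lemma chart_at:
  assumes "q \<in> points M"
  shows "chart_at M q \<in> atlas M" "q \<in> chart_dom (chart_at M q)"
proof -
  have "\<exists>c. c \<in> atlas M \<and> q \<in> chart_dom c"
    using assms unfolding Union_chart_dom[symmetric] by blast
  from someI_ex[OF this] show "chart_at M q \<in> atlas M" "q \<in> chart_dom (chart_at M q)"
    by (auto simp: chart_at_def)
qed

lemma chart_at_of_dom:
  assumes "c \<in> atlas M" "q \<in> chart_dom c"
  shows "chart_at M q \<in> atlas M" "q \<in> chart_dom (chart_at M q)"
  using chart_at[of q] chart_dom_subset[OF assms(1)] assms(2) by auto

lemma linear_tangent_coord:
  assumes "c \<in> atlas M" "q \<in> chart_dom c"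
  shows "linear (tangent_coord M c q)"
  using linear_transition_deriv[OF chart_at_of_dom(1)[OF assms] assms(1) chart_at_of_dom(2)[OF assms] assms(2)]
  unfolding tangent_coord_eq[abs_def] .

lemma transition_tangent_coord:
  assumes "c \<in> atlas M" "d \<in> atlas M" "q \<in> chart_dom c" "q \<in> chart_dom d"
  shows "transition_deriv c d q (tangent_coord M c q v) = tangent_coord M d q v"
  unfolding tangent_coord_eq using assms by (intro transition_deriv_trans chart_at_of_dom[of c])

lemma tangent_coord_chart_at: "q \<in> points M \<Longrightarrow> tangent_coord M (chart_at M q) q v = v"
  unfolding tangent_coord_eq by (intro transition_deriv_refl chart_at)

lemma tangent_coord_transition:
  assumes "c \<in> atlas M" "q \<in> chart_dom c"
  shows "tangent_coord M c q (transition_deriv c (chart_at M q) q u) = u"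
  using transition_deriv_trans[of c "chart_at M q" c q u] transition_deriv_refl[of c q u]
    chart_at_of_dom[OF assms] assms unfolding tangent_coord_eq by metis

lemma transition_chart_at_tangent_coord:
  assumes "c \<in> atlas M" "q \<in> chart_dom c"
  shows "transition_deriv c (chart_at M q) q (tangent_coord M c q v) = v"
  using transition_deriv_trans[of "chart_at M q" c "chart_at M q" q v]
    transition_deriv_refl[of "chart_at M q" q v]
    chart_at_of_dom[OF assms] assms unfolding tangent_coord_eq by metis

lemma tangent_coord_inject:
  assumes "c \<in> atlas M" "q \<in> chart_dom c"
  shows "tangent_coord M c q v = tangent_coord M c q w \<longleftrightarrow> v = w"
  using transition_chart_at_tangent_coord[OF assms, of v] transition_chart_at_tangent_coord[OF assms, of w]
  by metis

lemma vector_field_smooth: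
  "vector_field M X \<Longrightarrow> c \<in> atlas M \<Longrightarrow>
    smooth_on (chart_range c) (\<lambda>x. tangent_coord M c (chart_inv c x) (X (chart_inv c x)))"
  by (simp add: vector_field_def)

lemma vector_field_scale:
  assumes "vector_field M X"
  shows "vector_field M (\<lambda>q. k *\<^sub>R X q)"
  unfolding vector_field_def
proof (intro ballI)
  fix c assume c: "c \<in> atlas M"
  show "smooth_on (chart_range c) (\<lambda>x. tangent_coord M c (chart_inv c x) (k *\<^sub>R X (chart_inv c x)))"
    by (rule smooth_on_cong[THEN iffD1, OF open_chart_range[OF c] _ smooth_on_bounded_linear_comp
          [OF bounded_linear_scaleR_right[of k] open_chart_range[OF c] vector_field_smooth[OF assms c]]])
      (simp add: chart_inv_in linear_scale linear_tangent_coord[OF c])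
qed

lemma vector_field_diff:
  assumes "vector_field M X" "vector_field M Y"
  shows "vector_field M (\<lambda>q. X q - Y q)"
  unfolding vector_field_def
proof (intro ballI)
  fix c assume c: "c \<in> atlas M"
  show "smooth_on (chart_range c) (\<lambda>x. tangent_coord M c (chart_inv c x)
      (X (chart_inv c x) - Y (chart_inv c x)))"
    by (rule smooth_on_cong[THEN iffD1, OF open_chart_range[OF c] _ smooth_on_diff
          [OF open_chart_range[OF c] vector_field_smooth[OF assms(1) c] vector_field_smooth[OF assms(2) c]]])
      (simp add: chart_inv_in linear_diff linear_tangent_coord[OF c])
qed

lemma smooth_fun_const: "smooth_fun M (\<lambda>q. k)"
  by (auto simp: smooth_fun_def o_def intro: smooth_on_const open_chart_range)

text \<open>Extension by zero preserves smoothness: the support in \<open>c\<close> is compact, hence closed in the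
  Hausdorff space \<open>M\<close>, so that in any other chart the two open pieces cover the range.\<close>

lemma smooth_on_extend_by_zero:
  assumes "c \<in> atlas M" "d \<in> atlas M" "cball a r \<subseteq> chart_range c"
    and "smooth_on (chart_map d ` (chart_dom d \<inter> chart_dom c)) f"
    and zero: "\<And>q. q \<in> chart_dom d \<Longrightarrow> q \<notin> chart_inv c ` cball a r \<Longrightarrow> f (chart_map d q) = 0"
  shows "smooth_on (chart_range d) f"
proof (rule smooth_on_local[OF _ open_chart_range[OF assms(2)]])
  fix x assume "x \<in> chart_range d"
  then obtain q where q: "q \<in> chart_dom d" "x = chart_map d q" by auto
  show "\<exists>U. open U \<and> x \<in> U \<and> smooth_on (U \<inter> chart_range d) f"
  proof (cases "q \<in> chart_dom c")
    case True
    then show ?thesis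
      using smooth_on_subset[OF assms(4)] q open_overlap[OF assms(2,1)]
      by (intro exI[of _ "chart_map d ` (chart_dom d \<inter> chart_dom c)"]) auto
  next
    case False
    let ?V = "chart_dom d - chart_inv c ` cball a r"
    have "chart_inv c ` cball a r \<subseteq> chart_dom c"
      using assms(3) chart_inv_in by (meson image_subsetI subsetD)
    then have "q \<in> ?V" using q False by auto
    moreover have V: "open (chart_map d ` ?V)"
      by (rule open_chart_image[OF assms(2)])
        (use closedin_chart_inv_compact[OF assms(1) compact_cball assms(3)] openin_chart_dom[OF assms(2)]
          in \<open>auto intro: openin_diff\<close>)
    moreover have "smooth_on (chart_map d ` ?V) f"
      by (rule smooth_on_cong[THEN iffD1, OF V _ smooth_on_const[OF V, of 0]]) (use zero in auto)
    ultimately show ?thesis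
      using q smooth_on_subset[of "chart_map d ` ?V" f "chart_map d ` ?V \<inter> chart_range d"]
      by (intro exI[of _ "chart_map d ` ?V"]) blast
  qed
qed

lemma bump_outside_support:
  assumes "c \<in> atlas M" "r > 0" "q \<in> chart_dom c" "q \<notin> chart_inv c ` cball a r"
  shows "bump a r (chart_map c q) = 0"
proof -
  have "chart_map c q \<notin> ball a r"
    using assms(3,4) chart_inv_chart[OF assms(1,3)] by (metis ball_subset_cball image_eqI subsetD)
  then show ?thesis using bump_eq_0 assms(2) by blast
qed

lemma smooth_fun_bump:
  assumes "c \<in> atlas M" "r > 0" "cball a r \<subseteq> chart_range c" "smooth_on UNIV h"
  shows "smooth_fun M (\<lambda>q. if q \<in> chart_dom c then bump a r (chart_map c q) * h (chart_map c q) else 0)"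
    (is "smooth_fun M ?f")
  unfolding smooth_fun_def
proof (intro ballI)
  fix d assume d: "d \<in> atlas M"
  let ?U = "chart_map d ` (chart_dom d \<inter> chart_dom c)" and ?\<phi> = "chart_map c \<circ> chart_inv d"
  note U = open_overlap[OF d assms(1)]
  show "smooth_on (chart_range d) (?f \<circ> chart_inv d)"
  proof (rule smooth_on_extend_by_zero[OF assms(1) d assms(3)])
    have "smooth_on ?U (\<lambda>x. bump a r (?\<phi> x) * h (?\<phi> x))"
      by (rule smooth_on_mult[OF U
            smooth_on_compose[OF U smooth_on_transition[OF d assms(1)] smooth_on_bump[OF open_UNIV]]
            smooth_on_compose[OF U smooth_on_transition[OF d assms(1)] assms(4)]]) auto
    then show "smooth_on ?U (?f \<circ> chart_inv d)"
      by (rule smooth_on_cong[THEN iffD1, OF U, rotated]) (auto simp: chart_inv_chart[OF d])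
  next
    fix q assume "q \<in> chart_dom d" "q \<notin> chart_inv c ` cball a r"
    then show "(?f \<circ> chart_inv d) (chart_map d q) = 0"
      using bump_outside_support[OF assms(1,2), of q a] by (auto simp: chart_inv_chart[OF d])
  qed
qed

text \<open>The field with constant components \<open>u\<close> in the chart \<open>c\<close>, cut off by a bump. Applying
  \<open>transition_deriv c (chart_at M q) q\<close> converts \<open>u\<close> to the components that represent tangent vectors.\<close>

definition bump_field :: "('a, 'e) chart \<Rightarrow> 'e \<Rightarrow> real \<Rightarrow> 'e \<Rightarrow> 'a \<Rightarrow> 'e" where
  "bump_field c a r u q =
     (if q \<in> chart_dom c then bump a r (chart_map c q) *\<^sub>R transition_deriv c (chart_at M q) q u else 0)"

lemma tangent_coord_bump_field:
  "c \<in> atlas M \<Longrightarrow> d \<in> atlas M \<Longrightarrow> q \<in> chart_dom c \<Longrightarrow> q \<in> chart_dom d \<Longrightarrow>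
    tangent_coord M d q (bump_field c a r u q) = bump a r (chart_map c q) *\<^sub>R transition_deriv c d q u"
  using transition_tangent_coord[of c d q "transition_deriv c (chart_at M q) q u"]
  by (simp add: bump_field_def linear_scale linear_tangent_coord tangent_coord_transition)

lemma vector_field_bump_field:
  assumes "c \<in> atlas M" "r > 0" "cball a r \<subseteq> chart_range c"
  shows "vector_field M (bump_field c a r u)"
  unfolding vector_field_def
proof (intro ballI)
  fix d assume d: "d \<in> atlas M"
  let ?U = "chart_map d ` (chart_dom d \<inter> chart_dom c)" and ?\<phi> = "chart_map c \<circ> chart_inv d"
  let ?f = "\<lambda>x. tangent_coord M d (chart_inv d x) (bump_field c a r u (chart_inv d x))"
  note U = open_overlap[OF d assms(1)]
  show "smooth_on (chart_range d) ?f"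
  proof (rule smooth_on_extend_by_zero[OF assms(1) d assms(3)])
    have deriv: "smooth_on (chart_map c ` (chart_dom c \<inter> chart_dom d))
        (\<lambda>y. frechet_derivative (chart_map d \<circ> chart_inv c) (at y) u)"
      by (intro smooth_on_frechet_derivative smooth_on_transition assms(1) d)
    have bump: "smooth_on ?U (\<lambda>x. bump a r (?\<phi> x))"
      by (rule smooth_on_compose[OF U smooth_on_transition[OF d assms(1)] smooth_on_bump[OF open_UNIV]]) simp
    have "?\<phi> ` ?U \<subseteq> chart_map c ` (chart_dom c \<inter> chart_dom d)"
      by (auto simp: chart_inv_chart[OF d])
    note smooth_on_scaleR[OF U bump smooth_on_compose[OF U smooth_on_transition[OF d assms(1)] deriv this]]
    then show "smooth_on ?U ?f"
      by (rule smooth_on_cong[THEN iffD1, OF U, rotated])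
        (auto simp: chart_inv_chart[OF d] tangent_coord_bump_field[OF assms(1) d] transition_deriv_def)
  next
    fix q assume q: "q \<in> chart_dom d" "q \<notin> chart_inv c ` cball a r"
    then have "bump_field c a r u q = 0"
      using bump_outside_support[OF assms(1,2), of q a] by (auto simp: bump_field_def)
    then show "?f (chart_map d q) = 0"
      using q linear_0[OF linear_tangent_coord[OF d q(1)]] by (simp add: chart_inv_chart[OF d])
  qed
qed

lemma chart_ball:
  assumes "c \<in> atlas M" "q \<in> chart_dom c"
  obtains r where "r > 0" "cball (chart_map c q) r \<subseteq> chart_range c"
  using open_chart_range[OF assms(1)] assms(2) open_contains_cball by (metis imageI)

lemma vector_field_through:
  assumes "p \<in> points M"
  obtains X where "vector_field M X" "X p = v"
proof -
  let ?c = "chart_at M p"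
  note c = chart_at[OF assms]
  obtain r where r: "r > 0" "cball (chart_map ?c p) r \<subseteq> chart_range ?c"
    using chart_ball[OF c] .
  let ?k = "bump (chart_map ?c p) r (chart_map ?c p)"
  let ?X = "bump_field ?c (chart_map ?c p) r ((1 / ?k) *\<^sub>R v)"
  have "?k > 0" using r by (intro bump_pos) simp
  then have "?X p = v"
    using tangent_coord_bump_field[OF c(1) c(1) c(2) c(2)]
    by (simp add: tangent_coord_chart_at[OF assms] transition_deriv_refl[OF c])
  then show ?thesis using that vector_field_bump_field[OF c(1) r] by blast
qed

lemma dir_deriv_vanishing:
  assumes "p \<in> points M" "\<And>q. q \<in> points M \<Longrightarrow> f q = 0"
  shows "dir_deriv M p v f = 0"
proof -
  let ?c = "chart_at M p"
  note c = chart_at[OF assms(1)]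
  have "((\<lambda>x. 0) has_derivative (\<lambda>v. 0)) (at (chart_map ?c p))" by simp
  then have "(f \<circ> chart_inv ?c has_derivative (\<lambda>v. 0)) (at (chart_map ?c p))"
    by (rule has_derivative_transform_within_open[OF _ open_chart_range[OF c(1)]])
      (use subsetD[OF chart_dom_subset[OF c(1)]] c(2) in \<open>auto simp: chart_inv_chart[OF c(1)] assms(2)\<close>)
  from fun_cong[OF frechet_derivative_at[OF this], of v] show ?thesis
    unfolding dir_deriv_def by (rule sym)
qed

lemma dir_deriv_const: "dir_deriv M p v (\<lambda>q. k) = 0"
  by (simp add: dir_deriv_def o_def)

text \<open>A bump times a coordinate vanishing at \<open>p\<close> recovers one component of a tangent vector at \<open>p\<close>,
  so a tangent vector is determined by its action on smooth functions.\<close>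

lemma dir_deriv_separates:
  assumes "p \<in> points M" "\<And>f. smooth_fun M f \<Longrightarrow> dir_deriv M p v f = dir_deriv M p w f"
  shows "v = w"
proof (rule euclidean_eqI)
  fix b :: 'e assume "b \<in> Basis"
  let ?c = "chart_at M p" let ?a = "chart_map ?c p"
  note c = chart_at[OF assms(1)]
  obtain r where r: "r > 0" "cball ?a r \<subseteq> chart_range ?c"
    using chart_ball[OF c] .
  let ?f = "\<lambda>q. if q \<in> chart_dom ?c then
    bump ?a r (chart_map ?c q) * ((chart_map ?c q - ?a) \<bullet> b) else 0"
  have "smooth_fun M ?f"
    by (intro smooth_fun_bump c(1) r smooth_on_inner smooth_on_diff smooth_on_ident
        smooth_on_const open_UNIV)
  moreover have "dir_deriv M p u ?f = bump ?a r ?a * (u \<bullet> b)" for u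
  proof -
    have "(bump ?a r has_derivative frechet_derivative (bump ?a r) (at ?a)) (at ?a)"
      by (rule smooth_on_has_derivative[OF smooth_on_bump[OF open_UNIV]]) simp
    moreover have "((\<lambda>x. (x - ?a) \<bullet> b) has_derivative (\<lambda>u. u \<bullet> b)) (at ?a)"
      by (auto intro!: derivative_eq_intros)
    ultimately have "((\<lambda>x. bump ?a r x * ((x - ?a) \<bullet> b)) has_derivative
        (\<lambda>u. bump ?a r ?a * (u \<bullet> b))) (at ?a)"
      using has_derivative_mult by fastforce
    then have "(?f \<circ> chart_inv ?c has_derivative (\<lambda>u. bump ?a r ?a * (u \<bullet> b))) (at ?a)"
      by (rule has_derivative_transform_within_open[OF _ open_chart_range[OF c(1)]])
        (use c(2) in \<open>auto simp: chart_inv_chart[OF c(1)]\<close>)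
    from fun_cong[OF frechet_derivative_at[OF this], of u] show ?thesis
      unfolding dir_deriv_def by (rule sym)
  qed
  ultimately have "bump ?a r ?a * (v \<bullet> b) = bump ?a r ?a * (w \<bullet> b)"
    using assms(2)[of ?f] by simp
  moreover have "bump ?a r ?a > 0" using r by (intro bump_pos) simp
  ultimately show "v \<bullet> b = w \<bullet> b" by simp
qed

end

section \<open>Simultaneous diagonalization of two quadratic forms\<close>

lemma linear_term_zero_of_nonneg:
  fixes b c :: real
  assumes "\<And>t. 0 \<le> 2 * t * b + t\<^sup>2 * c" "c \<ge> 0"
  shows "b = 0"
proof -
  \<comment> \<open>Take \<open>t = - b / (c + 1)\<close>, close to the minimizer \<open>- b / c\<close> but defined also for \<open>c = 0\<close>.\<close>
  define d where "d = c + 1"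
  have "d > 0" using assms(2) by (simp add: d_def)
  have "0 \<le> (2 * (- b / d) * b + (- b / d)\<^sup>2 * c) * d\<^sup>2"
    by (rule mult_nonneg_nonneg[OF assms(1)[of "- b / d"] zero_le_power2])
  also have "\<dots> = - (b\<^sup>2 * (2 * d - c))"
    using \<open>d > 0\<close> by (simp add: field_simps power2_eq_square)
  finally show ?thesis using assms(2) by (simp add: d_def mult_le_0_iff)
qed

text \<open>The Riesz representation with respect to \<open>g\<close> in place of the given inner product.\<close>

lemma inner_product_represents:
  fixes g :: "'e::euclidean_space \<Rightarrow> 'e \<Rightarrow> real"
  assumes "bilinear g" "\<And>v. v \<noteq> 0 \<Longrightarrow> g v v > 0" "linear \<phi>"
  obtains y where "\<And>u. \<phi> u = g y u"
proof -
  define G where "G x = (\<Sum>b\<in>Basis. g x b *\<^sub>R b)" for x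
  have repr: "\<psi> u = (\<Sum>b\<in>Basis. \<psi> b *\<^sub>R b) \<bullet> u" if "linear \<psi>" for \<psi> :: "'e \<Rightarrow> real" and u
  proof -
    have "\<psi> u = \<psi> (\<Sum>b\<in>Basis. (u \<bullet> b) *\<^sub>R b)"
      by (simp add: euclidean_representation)
    also have "\<dots> = (\<Sum>b\<in>Basis. (u \<bullet> b) * \<psi> b)"
      by (simp add: linear_sum[OF that] linear_scale[OF that])
    also have "\<dots> = u \<bullet> (\<Sum>b\<in>Basis. \<psi> b *\<^sub>R b)"
      by (simp add: inner_sum_right mult.commute)
    finally show ?thesis by (simp only: inner_commute)
  qed
  have G: "g x u = G x \<bullet> u" for x u
    unfolding G_def by (rule repr) (use assms(1) in \<open>simp add: bilinear_def\<close>)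
  have "linear G"
  proof (rule linearI)
    show "G (x + y) = G x + G y" for x y
      by (simp add: G_def bilinear_ladd[OF assms(1)] scaleR_left_distrib sum.distrib)
    show "G (r *\<^sub>R x) = r *\<^sub>R G x" for r x
      by (simp add: G_def bilinear_lmul[OF assms(1)] scaleR_sum_right)
  qed
  moreover have "inj G"
    unfolding linear_injective_0[OF calculation] using G assms(2) by (metis inner_zero_left less_irrefl)
  ultimately have "surj G" by (rule linear_inj_imp_surj)
  then obtain y where y: "G y = (\<Sum>b\<in>Basis. \<phi> b *\<^sub>R b)" by (metis surjD)
  show ?thesis
    by (rule that[of y]) (simp only: repr[OF assms(3), symmetric] G y)
qed

text \<open>If the eigenvectors did not span, a maximizer of the Rayleigh quotient \<open>h w w / g w w\<close> on
  their \<open>g\<close>-orthogonal complement would be a further eigenvector.\<close>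

lemma span_relative_eigenvectors:
  fixes g h :: "'e::euclidean_space \<Rightarrow> 'e \<Rightarrow> real"
  assumes g: "bilinear g" "\<And>v w. g v w = g w v" "\<And>v. v \<noteq> 0 \<Longrightarrow> g v v > 0"
    and h: "bilinear h" "\<And>v w. h v w = h w v"
  shows "span {x. \<exists>\<mu>. \<forall>w. h x w = \<mu> * g x w} = UNIV"
proof (rule ccontr)
  define E where "E = {x. \<exists>\<mu>. \<forall>w. h x w = \<mu> * g x w}"
  define W where "W = {w. \<forall>v\<in>E. g v w = 0}"
  note bil = bilinear_ladd[OF g(1)] bilinear_radd[OF g(1)] bilinear_lmul[OF g(1)] bilinear_rmul[OF g(1)]
    bilinear_ladd[OF h(1)] bilinear_radd[OF h(1)] bilinear_lmul[OF h(1)] bilinear_rmul[OF h(1)]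
    bilinear_rzero[OF g(1)] bilinear_rzero[OF h(1)] bilinear_lzero[OF g(1)] bilinear_lzero[OF h(1)]
  assume "span {x. \<exists>\<mu>. \<forall>w. h x w = \<mu> * g x w} \<noteq> UNIV"
  then obtain a where a: "a \<noteq> 0" "\<forall>x\<in>span E. a \<bullet> x = 0"
    unfolding E_def[symmetric] using span_not_UNIV_orthogonal[of E] by blast
  obtain w where w: "\<And>u. a \<bullet> u = g w u"
    using inner_product_represents[OF g(1,3) bounded_linear.linear[OF bounded_linear_inner_right[of a]]]
    by blast
  have "w \<in> W"
    unfolding W_def mem_Collect_eq g(2)[of _ w] w[symmetric] using a(2) span_base by blast
  have "w \<noteq> 0"
    using a(1) w[of a] bilinear_lzero[OF g(1)] by (metis inner_eq_zero_iff)
  have W: "subspace W"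
    by (auto simp: subspace_def W_def bil)
  define K where "K = W \<inter> sphere 0 1"
  have "compact K"
    unfolding K_def using closed_subspace[OF W] by (simp add: closed_Int_compact)
  moreover have "(1 / norm w) *\<^sub>R w \<in> K"
    using \<open>w \<in> W\<close> \<open>w \<noteq> 0\<close> W by (auto simp: K_def subspace_scale)
  moreover have "continuous_on K (\<lambda>w. h w w / g w w)"
  proof (intro continuous_on_divide)
    show "continuous_on K (\<lambda>w. h w w)" "continuous_on K (\<lambda>w. g w w)"
      by (rule bounded_bilinear.continuous_on[OF bilinear_conv_bounded_bilinear[THEN iffD1]
            continuous_on_id continuous_on_id], fact)+
    show "\<forall>x\<in>K. g x x \<noteq> 0"
      using g(3) less_irrefl norm_zero zero_neq_one unfolding K_def by (metis IntE mem_sphere_0)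
  qed
  ultimately obtain w0 where w0: "w0 \<in> K" "\<And>y. y \<in> K \<Longrightarrow> h y y / g y y \<le> h w0 w0 / g w0 w0"
    using continuous_attains_sup[of K "\<lambda>w. h w w / g w w"] by blast
  define \<mu> where "\<mu> = h w0 w0 / g w0 w0"
  have "w0 \<noteq> 0" "w0 \<in> W" using w0(1) by (auto simp: K_def)
  define q where "q u v = \<mu> * g u v - h u v" for u v
  have q_nonneg: "q u u \<ge> 0" if "u \<in> W" for u
  proof (cases "u = 0")
    case False
    let ?k = "1 / norm u"
    have "?k *\<^sub>R u \<in> K"
      using that False W by (auto simp: K_def subspace_scale)
    then have "h (?k *\<^sub>R u) (?k *\<^sub>R u) / g (?k *\<^sub>R u) (?k *\<^sub>R u) \<le> \<mu>"
      unfolding \<mu>_def by (rule w0(2))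
    then have "h u u / g u u \<le> \<mu>" using False by (simp add: bil)
    then show ?thesis using g(3)[OF False] by (simp add: q_def divide_le_eq)
  qed (simp add: q_def bil)
  \<comment> \<open>First variation at the maximizer, in direction \<open>u\<close>.\<close>
  have q_zero: "q w0 u = 0" if "u \<in> W" for u
  proof (rule linear_term_zero_of_nonneg[OF _ q_nonneg[OF that]])
    fix t
    have "w0 + t *\<^sub>R u \<in> W"
      using W \<open>w0 \<in> W\<close> that by (simp add: subspace_add subspace_scale)
    then have "0 \<le> q (w0 + t *\<^sub>R u) (w0 + t *\<^sub>R u)" by (rule q_nonneg)
    also have "\<dots> = q w0 w0 + 2 * t * q w0 u + t\<^sup>2 * q u u"
      by (simp add: q_def bil g(2)[of u w0] h(2)[of u w0] algebra_simps power2_eq_square)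
    also have "q w0 w0 = 0" using g(3)[OF \<open>w0 \<noteq> 0\<close>] by (simp add: q_def \<mu>_def)
    finally show "0 \<le> 2 * t * q w0 u + t\<^sup>2 * q u u" by simp
  qed
  \<comment> \<open>The form \<open>q w0\<close> vanishes on \<open>W\<close>, and on \<open>E\<close> as well. Its \<open>g\<close>-gradient \<open>y\<close> is therefore
    in \<open>W\<close>, and evaluating at \<open>y\<close> gives \<open>y = 0\<close>: \<open>w0\<close> is an eigenvector.\<close>
  have "linear (q w0)"
    by (rule linearI) (simp_all add: q_def bil algebra_simps)
  then obtain y where y: "\<And>u. q w0 u = g y u"
    using inner_product_represents[OF g(1,3) \<open>linear (q w0)\<close>] by blast
  have "g v y = 0" if "v \<in> E" for v
  proof -
    obtain l where l: "\<And>w. h v w = l * g v w" using \<open>v \<in> E\<close> unfolding E_def by blast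
    have "g v w0 = 0" using \<open>w0 \<in> W\<close> \<open>v \<in> E\<close> by (simp add: W_def)
    then show ?thesis using y[of v] l[of w0] by (simp add: q_def g(2)[of _ v] h(2)[of _ v])
  qed
  then have "y \<in> W" by (simp add: W_def)
  from q_zero[OF this] have "g y y = 0" by (simp only: y)
  then have "y = 0" using g(3)[of y] by (metis less_irrefl)
  then have "q w0 u = 0" for u
    by (simp only: y bil)
  then have "w0 \<in> E" unfolding E_def mem_Collect_eq q_def by (intro exI[of _ \<mu>]) simp
  then have "g w0 w0 = 0" using \<open>w0 \<in> W\<close> unfolding W_def by blast
  then show False using g(3)[OF \<open>w0 \<noteq> 0\<close>] by simp
qed

section \<open>Uniqueness of the Levi-Civita connection\<close>

lemma riemannian_metricD:
  assumes "riemannian_metric M g" "p \<in> points M"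
  shows "bilinear (g p)" "g p v w = g p w v" "v \<noteq> 0 \<Longrightarrow> g p v v > 0"
  using assms(1)[unfolded riemannian_metric_def, THEN conjunct1, rule_format, OF assms(2)] by blast+

lemma torsion_freeD:
  assumes "torsion_free M nabla" "vector_field M X" "vector_field M Y" "smooth_fun M f" "p \<in> points M"
  shows "dir_deriv M p (nabla X Y p - nabla Y X p) f =
    dir_deriv M p (X p) (\<lambda>q. dir_deriv M q (Y q) f) - dir_deriv M p (Y p) (\<lambda>q. dir_deriv M q (X q) f)"
  by (rule assms(1)[unfolded torsion_free_def, rule_format, OF assms(2-5)])

lemma metric_compatibleD:
  assumes "metric_compatible M g nabla" "vector_field M X" "vector_field M Y" "vector_field M Z"
    "p \<in> points M"
  shows "dir_deriv M p (X p) (\<lambda>q. g q (Y q) (Z q)) = g p (nabla X Y p) (Z p) + g p (Y p) (nabla X Z p)"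
  by (rule assms(1)[unfolded metric_compatible_def, rule_format, OF assms(2-5)])

lemma levi_civitaD:
  assumes "levi_civita M g nabla"
  shows "affine_connection M nabla" "torsion_free M nabla" "metric_compatible M g nabla"
  using assms by (simp_all add: levi_civita_def)

context smooth_mfd
begin

text \<open>The difference of two connections is symmetric because both are torsion free, and skew with
  respect to \<open>g\<close> because both preserve \<open>g\<close>; a trilinear form which is symmetric in the first two
  and skew in the last two arguments vanishes.\<close>

lemma levi_civita_unique:
  assumes g: "riemannian_metric M g" and "levi_civita M g nabla" "levi_civita M g nabla'"
    and X: "vector_field M X" and Y: "vector_field M Y" and p: "p \<in> points M"
  shows "nabla X Y p = nabla' X Y p"
proof -
  define D where "D X Y = nabla X Y p - nabla' X Y p" for X Y
  note lc = levi_civitaD[OF assms(2)] levi_civitaD[OF assms(3)]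
  note bil = bilinear_lsub[OF riemannian_metricD(1)[OF g p]] bilinear_rsub[OF riemannian_metricD(1)[OF g p]]
  have sym: "D X Y = D Y X" if XY: "vector_field M X" "vector_field M Y" for X Y
  proof -
    have "nabla X Y p - nabla Y X p = nabla' X Y p - nabla' Y X p" (is "?l = ?r")
      by (rule dir_deriv_separates[OF p])
        (simp only: torsion_freeD[OF lc(2) XY _ p] torsion_freeD[OF lc(5) XY _ p])
    then have "?l - ?r = 0" by (simp only: right_minus_eq)
    moreover have "?l - ?r = D X Y - D Y X" by (simp add: D_def)
    ultimately show ?thesis by (metis right_minus_eq)
  qed
  have skew: "g p (D X Y) (Z p) = - g p (D X Z) (Y p)"
    if XYZ: "vector_field M X" "vector_field M Y" "vector_field M Z" for X Y Z
  proof -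
    have "g p (nabla X Y p) (Z p) + g p (Y p) (nabla X Z p) =
        g p (nabla' X Y p) (Z p) + g p (Y p) (nabla' X Z p)"
      using metric_compatibleD[OF lc(3) XYZ p] metric_compatibleD[OF lc(6) XYZ p] by simp
    then show ?thesis
      unfolding D_def bil riemannian_metricD(2)[OF g p, of "Y p"] by linarith
  qed
  \<comment> \<open>Alternating skewness and symmetry three times reverses the sign.\<close>
  have zero: "g p (D X Y) (Z p) = 0" if XYZ: "vector_field M X" "vector_field M Y" "vector_field M Z" for X Y Z
    using skew[OF XYZ] skew[OF XYZ(3,1,2)] skew[OF XYZ(2,3,1)]
    unfolding sym[OF XYZ(1,2)] sym[OF XYZ(2,3)] sym[OF XYZ(1,3)] by linarith
  have "vector_field M (nabla X Y)" "vector_field M (nabla' X Y)"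
    using lc X Y by (auto simp: affine_connection_def)
  from zero[OF X Y vector_field_diff[OF this]] have "g p (D X Y) (D X Y) = 0"
    by (simp add: D_def)
  then have "D X Y = 0" using riemannian_metricD(3)[OF g p] by (metis less_irrefl)
  then show ?thesis by (simp add: D_def)
qed

section \<open>The one-form vanishes on the image of \<open>P\<close>\<close>

text \<open>Let \<open>X p\<close> be an eigenvector, \<open>gbar (X p) = \<mu> g (X p)\<close>; then \<open>P (X p)\<close> is one, too, since \<open>P\<close> is
  skew for both metrics. Differentiating the identities \<open>g (P X) X = 0\<close> and \<open>gbar (P X) X = 0\<close> along
  \<open>X\<close> with the respective connections and subtracting \<open>\<mu>\<close> times the former, all derivatives of \<open>P\<close>
  and \<open>X\<close> cancel. With \<open>D = nablabar - nabla\<close> there remains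
  \<open>gbar (D X (P X)) X + gbar (P X) (D X X) = 0\<close>, and by \<open>Q P = 0\<close> and skewness the left-hand side is
  \<open>\<Phi> (P X) gbar X X\<close>. As the eigenvectors span the tangent space, \<open>\<Phi> \<circ> P = 0\<close>.\<close>

lemma one_form_P_zero:
  assumes g: "riemannian_metric M g" and gbar: "riemannian_metric M gbar"
    and P: "endo_field M P"
    and PQ: "PQ_compatible M P Q 0 g gbar"
    and lc: "levi_civita M g nabla" "levi_civita M gbar nablabar" and \<Phi>: "one_form M \<Phi>"
    and D: "\<And>X Y p. vector_field M X \<Longrightarrow> vector_field M Y \<Longrightarrow> p \<in> points M \<Longrightarrow>
        nablabar X Y p - nabla X Y p =
              \<Phi> p (X p) *\<^sub>R Y p + \<Phi> p (Y p) *\<^sub>R X p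
              - \<Phi> p (P p (X p)) *\<^sub>R Q p (Y p) - \<Phi> p (P p (Y p)) *\<^sub>R Q p (X p)"
    and p: "p \<in> points M"
  shows "\<Phi> p (P p v) = 0"
proof -
  note gp = riemannian_metricD[OF g p] and hp = riemannian_metricD[OF gbar p]
  have gP: "g q (P q v) w = - g q v (P q w)" and hP: "gbar q (P q v) w = - gbar q v (P q w)"
    and hQ: "gbar q (Q q v) w = - gbar q v (Q q w)"
    and PQ0: "P q (Q q v) = 0" if "q \<in> points M" for q v w
    using PQ that by (auto simp: PQ_compatible_def skew_wrt_def)
  have gP0: "g q (P q v) v = 0" and hP0: "gbar q (P q v) v = 0" and hQ0: "gbar q (Q q v) v = 0"
    if "q \<in> points M" for q v
    using gP[OF that, of v v] hP[OF that, of v v] hQ[OF that, of v v]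
      riemannian_metricD(2)[OF g that, of v "P q v"] riemannian_metricD(2)[OF gbar that, of v "P q v"]
      riemannian_metricD(2)[OF gbar that, of v "Q q v"] by linarith+
  \<comment> \<open>\<open>Q P\<close> is the \<open>gbar\<close>-adjoint of \<open>P Q = 0\<close>.\<close>
  have QP0: "Q p (P p v) = 0" for v
  proof (rule ccontr)
    assume "Q p (P p v) \<noteq> 0"
    then have "gbar p (Q p (P p v)) (Q p (P p v)) > 0" by (rule hp(3))
    then show False
      by (simp add: hQ[OF p] hP[OF p] PQ0[OF p] bilinear_rzero[OF hp(1)])
  qed
  have linP: "linear (P p)" using P p by (simp add: endo_field_def)
  have lin\<Phi>: "linear (\<Phi> p)" using \<Phi> p by (simp add: one_form_def)
  have eigen: "\<Phi> p (P p x) = 0" if ex: "\<exists>\<mu>. \<forall>w. gbar p x w = \<mu> * g p x w" for x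
  proof (cases "x = 0")
    case True
    then show ?thesis by (simp add: linear_0[OF linP] linear_0[OF lin\<Phi>])
  next
    case False
    obtain \<mu> where \<mu>: "\<And>w. gbar p x w = \<mu> * g p x w" using ex by blast
    have \<mu>P: "gbar p (P p x) w = \<mu> * g p (P p x) w" for w
      by (simp add: gP[OF p] hP[OF p] \<mu>)
    obtain X where X: "vector_field M X" "X p = x" using vector_field_through[OF p] .
    define PX where "PX = (\<lambda>q. P q (X q))"
    have PX: "vector_field M PX" using P X(1) by (simp add: endo_field_def PX_def)
    have "dir_deriv M p x (\<lambda>q. g q (PX q) (X q)) =
          g p (nabla X PX p) x + g p (PX p) (nabla X X p)"
      and "dir_deriv M p x (\<lambda>q. gbar q (PX q) (X q)) =
          gbar p (nablabar X PX p) x + gbar p (PX p) (nablabar X X p)"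
      using metric_compatibleD[OF levi_civitaD(3)[OF lc(1)] X(1) PX X(1) p]
        metric_compatibleD[OF levi_civitaD(3)[OF lc(2)] X(1) PX X(1) p]
      by (simp_all only: X(2))
    moreover have "dir_deriv M p x (\<lambda>q. g q (PX q) (X q)) = 0"
      "dir_deriv M p x (\<lambda>q. gbar q (PX q) (X q)) = 0"
      using gP0 hP0 by (auto simp: PX_def intro!: dir_deriv_vanishing p)
    ultimately have "g p (nabla X PX p) x + g p (PX p) (nabla X X p) = 0"
      and bar: "gbar p (nablabar X PX p) x + gbar p (PX p) (nablabar X X p) = 0"
      by simp_all
    then have "\<mu> * g p x (nabla X PX p) + \<mu> * g p (PX p) (nabla X X p) = 0"
      unfolding distrib_left[symmetric] gp(2)[of x] by simp
    then have "gbar p (nabla X PX p) x + gbar p (PX p) (nabla X X p) = 0"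
      using \<mu> \<mu>P X(2) by (simp add: hp(2)[of _ x] PX_def)
    with bar have "gbar p (nablabar X PX p - nabla X PX p) x
        + gbar p (PX p) (nablabar X X p - nabla X X p) = 0"
      by (simp add: bilinear_lsub[OF hp(1)] bilinear_rsub[OF hp(1)])
    then have "\<Phi> p (P p x) * gbar p x x = 0"
      unfolding D[OF X(1) PX p] D[OF X(1) X(1) p]
      by (simp add: X(2) PX_def QP0 hP0[OF p] hQ0[OF p] hp(2)[of "P p x" "Q p x"] hQ[OF p]
          bilinear_lsub[OF hp(1)] bilinear_rsub[OF hp(1)] bilinear_ladd[OF hp(1)]
          bilinear_radd[OF hp(1)] bilinear_lmul[OF hp(1)] bilinear_rmul[OF hp(1)]
          bilinear_rzero[OF hp(1)])
    then show ?thesis using hp(3)[OF False] by simp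
  qed
  have "linear (\<lambda>v. \<Phi> p (P p v))"
    using linear_compose[OF linP lin\<Phi>] by (simp add: o_def)
  moreover have "span {x. \<exists>\<mu>. \<forall>w. gbar p x w = \<mu> * g p x w} = UNIV"
    by (rule span_relative_eigenvectors[OF gp(1) gp(2) gp(3) hp(1) hp(2)])
  then have "v \<in> span {x. \<exists>\<mu>. \<forall>w. gbar p x w = \<mu> * g p x w}" by simp
  ultimately show ?thesis
    using linear_eq_0_on_span[of "\<lambda>v. \<Phi> p (P p v)" "{x. \<exists>\<mu>. \<forall>w. gbar p x w = \<mu> * g p x w}" v] eigen
    by blast
qed

end

section \<open>Solving the reparametrization equation on an interval\<close>

lemma open_interval_antiderivative:
  fixes f :: "real \<Rightarrow> real"
  assumes "open_interval J" "continuous_on J f"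
  obtains F where "\<And>x. x \<in> J \<Longrightarrow> (F has_real_derivative f x) (at x)"
proof -
  have J: "open J" "is_interval J" "J \<noteq> {}" using assms(1) by (auto simp: open_interval_def)
  let ?a = "Inf (ereal ` J)" and ?b = "Sup (ereal ` J)"
  have inside: "?a < ereal x \<and> ereal x < ?b" if x: "x \<in> J" for x
  proof -
    obtain e where e: "e > 0" "cball x e \<subseteq> J"
      using J(1) x unfolding open_contains_cball by blast
    then have "x - e \<in> J" "x + e \<in> J"
      using subsetD[OF e(2), of "x - e"] subsetD[OF e(2), of "x + e"] by (simp_all add: dist_real_def)
    then have "?a \<le> ereal (x - e)" "ereal (x + e) \<le> ?b"
      by (auto intro: Inf_lower Sup_upper)
    moreover have "ereal (x - e) < ereal x" "ereal x < ereal (x + e)" using e(1) by auto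
    ultimately show ?thesis
      using le_less_trans[of ?a "ereal (x - e)"] less_le_trans[of "ereal x" "ereal (x + e)"] by simp
  qed
  have conv: "x \<in> J" if ab: "?a < ereal x" "ereal x < ?b" for x
  proof -
    obtain y where "y \<in> J" "y < x" using ab(1) by (auto simp: Inf_less_iff)
    moreover obtain z where "z \<in> J" "x < z" using ab(2) by (auto simp: less_Sup_iff)
    ultimately show ?thesis using mem_is_interval_1_I[OF J(2), of y z x] by simp
  qed
  obtain x0 where "x0 \<in> J" using J(3) by blast
  then have "?a < ?b" using inside[OF \<open>x0 \<in> J\<close>] less_trans[of ?a "ereal x0" ?b] by simp
  moreover have "isCont f x" if "?a < ereal x" "ereal x < ?b" for x
    using continuous_on_eq_continuous_at[OF J(1), of f] assms(2) conv[OF that] by simp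
  ultimately have "\<exists>F. \<forall>x. ?a < ereal x \<longrightarrow> ereal x < ?b \<longrightarrow> (F has_vector_derivative f x) (at x)"
    by (rule einterval_antiderivative)
  then obtain F where
    F: "\<And>x. ?a < ereal x \<Longrightarrow> ereal x < ?b \<Longrightarrow> (F has_vector_derivative f x) (at x)"
    by blast
  show ?thesis
  proof (rule that[of F])
    show "(F has_real_derivative f x) (at x)" if "x \<in> J" for x
      unfolding has_real_derivative_iff_has_vector_derivative using F inside[OF that] by blast
  qed
qed

lemma Ck_on_Suc_of_real_derivative:
  fixes F f :: "real \<Rightarrow> real"
  assumes "open S" "\<And>t. t \<in> S \<Longrightarrow> (F has_real_derivative f t) (at t)" "Ck_on k S f"
  shows "Ck_on (Suc k) S F"
proof (rule Ck_on_SucI[OF assms(1), where f' = "\<lambda>t v. f t * v"])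
  show "(F has_derivative (\<lambda>v. f t * v)) (at t)" if "t \<in> S" for t
    using assms(2)[OF that] by (simp add: has_field_derivative_def)
  show "Ck_on k S (\<lambda>t. f t * v)" for v
    by (rule Ck_on_bounded_linear_comp[OF bounded_linear_mult_left assms(1,3)])
qed

lemma smooth_on_of_real_derivative:
  fixes F f :: "real \<Rightarrow> real"
  assumes "open S" "\<And>t. t \<in> S \<Longrightarrow> (F has_real_derivative f t) (at t)" "smooth_on S f"
  shows "smooth_on S F"
  unfolding smooth_on_def
  using Ck_on_Suc_imp[OF Ck_on_Suc_of_real_derivative[OF assms(1,2) smooth_onD[OF assms(3)]]] by blast

text \<open>The equation \<open>\<theta>'' = - a(\<theta>) \<theta>'\<^sup>2\<close> becomes the linear equation \<open>s'' = a s'\<close> for the inverse \<open>s\<close>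
  of \<open>\<theta>\<close>, which is solved on all of \<open>J\<close> by \<open>s' = exp A\<close> with \<open>A' = a\<close>.\<close>

lemma reparametrization_equation_solution:
  fixes a :: "real \<Rightarrow> real"
  assumes "open_interval J" "smooth_on J a"
  obtains J' \<theta> \<theta>' where "reparametrization J' J \<theta>"
    "\<And>t. t \<in> J' \<Longrightarrow> (\<theta> has_real_derivative \<theta>' t) (at t)"
    "\<And>t. t \<in> J' \<Longrightarrow> \<theta>' t \<noteq> 0"
    "\<And>t. t \<in> J' \<Longrightarrow> (\<theta>' has_real_derivative - a (\<theta> t) * (\<theta>' t)\<^sup>2) (at t)"
proof -
  have J: "open J" "is_interval J" "J \<noteq> {}" using assms(1) by (auto simp: open_interval_def)
  obtain A where A: "\<And>t. t \<in> J \<Longrightarrow> (A has_real_derivative a t) (at t)"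
    using open_interval_antiderivative[OF assms(1) smooth_on_imp_continuous_on[OF assms(2)]] by blast
  have "smooth_on J A" by (rule smooth_on_of_real_derivative[OF J(1) A assms(2)])
  then have expA: "smooth_on J (\<lambda>t. exp (A t))" by (rule smooth_on_exp[OF J(1)])
  obtain s where s: "\<And>t. t \<in> J \<Longrightarrow> (s has_real_derivative exp (A t)) (at t)"
    using open_interval_antiderivative[OF assms(1) smooth_on_imp_continuous_on[OF expA]] by blast
  have less: "s x < s y" if "x \<in> J" "y \<in> J" "x < y" for x y
  proof (rule DERIV_pos_imp_increasing[OF \<open>x < y\<close>])
    fix z assume "x \<le> z" "z \<le> y"
    then have "z \<in> J" using mem_is_interval_1_I[OF J(2) that(1,2)] by simp
    then show "\<exists>l. (s has_real_derivative l) (at z) \<and> 0 < l" using s exp_gt_zero by blast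
  qed
  have inj: "inj_on s J"
    using less by (intro inj_onI) (metis less_irrefl linorder_neqE)
  have cont: "continuous_on J s"
    using s by (meson DERIV_isCont continuous_at_imp_continuous_on)
  define J' where "J' = s ` J"
  define \<theta> where "\<theta> = inv_into J s"
  define \<theta>' where "\<theta>' t = exp (- A (\<theta> t))" for t
  have "open J'" unfolding J'_def by (rule invariance_of_domain[OF cont J(1) inj])
  moreover have "is_interval J'"
    using connected_continuous_image[OF cont] J(2) by (simp add: J'_def is_interval_connected_1)
  ultimately have J': "open_interval J'" using J(3) by (simp add: open_interval_def J'_def)
  have bij: "bij_betw \<theta> J' J"
    unfolding \<theta>_def J'_def by (rule bij_betw_inv_into[OF inj_on_imp_bij_betw[OF inj]])
  then have \<theta>_in: "\<theta> t \<in> J" if "t \<in> J'" for t using that by (rule bij_betwE[rule_format])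
  have d\<theta>: "(\<theta> has_real_derivative \<theta>' t) (at t)" if t: "t \<in> J'" for t
  proof -
    have "(\<theta> has_derivative (\<lambda>v. inverse (exp (A (\<theta> t))) * v)) (at (s (\<theta> t)))"
    proof (rule has_derivative_inverse_strong[OF J(1) \<theta>_in[OF t] cont])
      show "(s has_derivative (\<lambda>v. exp (A (\<theta> t)) * v)) (at (\<theta> t))"
        using s[OF \<theta>_in[OF t]] by (simp add: has_field_derivative_def)
    qed (auto simp: \<theta>_def inv_into_f_f[OF inj])
    moreover have "s (\<theta> t) = t" using t by (simp add: \<theta>_def J'_def f_inv_into_f)
    ultimately show ?thesis by (simp add: \<theta>'_def exp_minus has_field_derivative_def)
  qed
  have d\<theta>': "(\<theta>' has_real_derivative - a (\<theta> t) * (\<theta>' t)\<^sup>2) (at t)" if t: "t \<in> J'" for t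
  proof -
    have "((\<lambda>t. A (\<theta> t)) has_real_derivative a (\<theta> t) * \<theta>' t) (at t)"
      by (rule DERIV_chain2[OF A[OF \<theta>_in[OF t]] d\<theta>[OF t]])
    then have "((\<lambda>t. exp (- A (\<theta> t))) has_real_derivative
        exp (- A (\<theta> t)) * - (a (\<theta> t) * \<theta>' t)) (at t)"
      by (intro DERIV_chain2[OF DERIV_exp] DERIV_minus)
    then show ?thesis by (simp add: \<theta>'_def[abs_def] power2_eq_square algebra_simps)
  qed
  \<comment> \<open>Bootstrapping: \<open>\<theta>' = exp (- A (\<theta>))\<close> is as regular as \<open>\<theta>\<close> itself.\<close>
  have "Ck_on k J' \<theta>" for k
  proof (induction k)
    case 0
    show ?case
      unfolding Ck_on.simps using d\<theta> by (meson DERIV_isCont continuous_at_imp_continuous_on)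
  next
    case (Suc k)
    have "Ck_on k J' (\<lambda>t. - A (\<theta> t))"
      by (rule Ck_on_bounded_linear_comp[OF bounded_linear_minus[OF bounded_linear_ident] \<open>open J'\<close>
            Ck_on_compose[OF \<open>open J'\<close> Suc smooth_onD[OF \<open>smooth_on J A\<close>]]])
        (use \<theta>_in in auto)
    from Ck_on_compose[OF \<open>open J'\<close> this Ck_on_exp] have "Ck_on k J' \<theta>'"
      by (simp add: \<theta>'_def[abs_def])
    with \<open>open J'\<close> d\<theta> show ?case by (rule Ck_on_Suc_of_real_derivative)
  qed
  then have "reparametrization J' J \<theta>"
    using J' bij DERIV_imp_deriv[OF d\<theta>]
    by (simp add: reparametrization_def smooth_on_def \<theta>'_def)
  from that[OF this d\<theta> _ d\<theta>'] show ?thesis by (simp add: \<theta>'_def)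
qed

lemma reparametrization_compose:
  assumes "reparametrization J I \<tau>" "reparametrization J' J \<theta>"
  shows "reparametrization J' I (\<tau> \<circ> \<theta>)"
proof -
  have J: "open J'" "smooth_on J' \<theta>" "smooth_on J \<tau>" "\<theta> ` J' = J"
    using assms by (auto simp: reparametrization_def open_interval_def bij_betw_def)
  have "deriv (\<tau> \<circ> \<theta>) t \<noteq> 0" if t: "t \<in> J'" for t
  proof -
    have "\<theta> t \<in> J" using J(4) t by blast
    have "\<theta> differentiable at t" "\<tau> differentiable at (\<theta> t)"
      using smooth_on_differentiable[OF J(2) t] smooth_on_differentiable[OF J(3) \<open>\<theta> t \<in> J\<close>] .
    then have "deriv (\<tau> \<circ> \<theta>) t = deriv \<tau> (\<theta> t) * deriv \<theta> t"
      by (intro deriv_chain) (simp_all add: field_differentiable_def real_differentiable_def)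
    then show ?thesis
      using assms t \<open>\<theta> t \<in> J\<close> by (simp add: reparametrization_def)
  qed
  moreover have "smooth_on J' (\<tau> \<circ> \<theta>)"
    unfolding o_def by (rule smooth_on_compose[OF J(1-3)]) (simp add: J(4))
  ultimately show ?thesis
    using assms bij_betw_trans[of \<theta> J' J \<tau> I] by (simp add: reparametrization_def)
qed

section \<open>Reparametrizing geodesics\<close>

text \<open>The components refer to the selected chart at the moving point \<open>\<sigma> t\<close>, so that \<open>\<Phi> (\<sigma> t)\<close> applies; as
  a function of \<open>t\<close> with values in the model space it need not even be continuous.\<close>

definition velocity :: "('a, 'e::euclidean_space) manifold \<Rightarrow> (real \<Rightarrow> 'a) \<Rightarrow> real \<Rightarrow> 'e" where
  "velocity M \<sigma> t = vector_derivative (chart_map (chart_at M (\<sigma> t)) \<circ> \<sigma>) (at t)"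

context smooth_mfd
begin

lemma one_form_uminus:
  assumes "one_form M \<Phi>"
  shows "one_form M (\<lambda>p v. - \<Phi> p v)"
  unfolding one_form_def
proof (intro conjI ballI allI impI)
  show "linear (\<lambda>v. - \<Phi> p v)" if "p \<in> points M" for p
    using assms that by (intro linear_compose_neg) (simp add: one_form_def)
  show "smooth_fun M (\<lambda>p. - \<Phi> p (X p))" if "vector_field M X" for X
  proof -
    have "smooth_fun M (\<lambda>p. \<Phi> p (X p))" using assms that by (simp add: one_form_def)
    then have "smooth_on (chart_range c) (\<lambda>x. - ((\<lambda>p. \<Phi> p (X p)) \<circ> chart_inv c) x)" if "c \<in> atlas M" for c
      using that by (intro smooth_on_bounded_linear_comp[OF bounded_linear_minus[OF bounded_linear_ident]
            open_chart_range]) (simp_all only: smooth_fun_def)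
    then show ?thesis by (simp add: smooth_fun_def o_def)
  qed
qed

lemma smooth_curve_in_points: "smooth_curve M J \<sigma> \<Longrightarrow> t \<in> J \<Longrightarrow> \<sigma> t \<in> points M"
  by (auto simp: smooth_curve_def continuous_map_def)

lemma open_curve_preimage:
  assumes "smooth_curve M J \<sigma>" "openin (mtop M) U"
  shows "open {t \<in> J. \<sigma> t \<in> U}"
proof -
  have "continuous_map (top_of_set J) (mtop M) \<sigma>" "open J"
    using assms(1) by (auto simp: smooth_curve_def open_interval_def)
  from openin_continuous_map_preimage[OF this(1) assms(2)] show ?thesis
    using openin_open_trans[OF _ \<open>open J\<close>] by simp
qed

lemma smooth_on_curve_chart:
  "smooth_curve M J \<sigma> \<Longrightarrow> c \<in> atlas M \<Longrightarrow> smooth_on {t \<in> J. \<sigma> t \<in> chart_dom c} (chart_map c \<circ> \<sigma>)"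
  by (simp add: smooth_curve_def)

lemma tangent_coord_velocity:
  assumes \<sigma>: "smooth_curve M J \<sigma>" and c: "c \<in> atlas M" and t: "t \<in> J" "\<sigma> t \<in> chart_dom c"
  shows "tangent_coord M c (\<sigma> t) (velocity M \<sigma> t) = vector_derivative (chart_map c \<circ> \<sigma>) (at t)"
proof -
  let ?d = "chart_at M (\<sigma> t)"
  note d = chart_at[OF smooth_curve_in_points[OF \<sigma> t(1)]]
  have "((chart_map ?d \<circ> \<sigma>) has_vector_derivative velocity M \<sigma> t) (at t)"
    unfolding velocity_def
    by (rule smooth_on_has_vector_derivative[OF smooth_on_curve_chart[OF \<sigma> d(1)]]) (use t d in simp)
  then have "((chart_map ?d \<circ> \<sigma>) has_derivative (\<lambda>h. h *\<^sub>R velocity M \<sigma> t)) (at t)"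
    by (simp add: has_vector_derivative_def)
  moreover have "((chart_map c \<circ> chart_inv ?d) has_derivative transition_deriv ?d c (\<sigma> t))
      (at ((chart_map ?d \<circ> \<sigma>) t))"
    using transition_has_derivative[OF d(1) c d(2) t(2)] by simp
  ultimately have "((chart_map c \<circ> chart_inv ?d) \<circ> (chart_map ?d \<circ> \<sigma>) has_derivative
      transition_deriv ?d c (\<sigma> t) \<circ> (\<lambda>h. h *\<^sub>R velocity M \<sigma> t)) (at t)"
    by (rule diff_chain_at)
  then have "(chart_map c \<circ> \<sigma> has_derivative
      transition_deriv ?d c (\<sigma> t) \<circ> (\<lambda>h. h *\<^sub>R velocity M \<sigma> t)) (at t)"
    by (rule has_derivative_transform_within_open[OF _ open_curve_preimage[OF \<sigma> openin_chart_dom[OF d(1)]]])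
      (use t d in \<open>auto simp: chart_inv_chart[OF d(1)]\<close>)
  then have "(chart_map c \<circ> \<sigma> has_vector_derivative tangent_coord M c (\<sigma> t) (velocity M \<sigma> t)) (at t)"
    by (simp add: has_vector_derivative_def o_def tangent_coord_eq
        linear_scale[OF linear_transition_deriv[OF d(1) c d(2) t(2)]])
  then show ?thesis by (rule vector_derivative_at[symmetric])
qed

text \<open>Near a point the components of \<open>\<Phi>\<close> in a chart are the smooth functions \<open>\<Phi> B\<^sub>b\<close> for the bump
  fields \<open>B\<^sub>b\<close> in the coordinate directions, divided by the bump.\<close>

lemma smooth_on_one_form_velocity:
  assumes \<sigma>: "smooth_curve M J \<sigma>" and \<Phi>: "one_form M \<Phi>"
  shows "smooth_on J (\<lambda>t. \<Phi> (\<sigma> t) (velocity M \<sigma> t))"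
proof (rule smooth_on_local)
  show J: "open J" using \<sigma> by (simp add: smooth_curve_def open_interval_def)
  fix t0 assume t0: "t0 \<in> J"
  let ?c = "chart_at M (\<sigma> t0)"
  note c = chart_at[OF smooth_curve_in_points[OF \<sigma> t0]]
  define x where "x = chart_map ?c \<circ> \<sigma>"
  define T where "T = {t \<in> J. \<sigma> t \<in> chart_dom ?c}"
  have T: "open T" unfolding T_def by (rule open_curve_preimage[OF \<sigma> openin_chart_dom[OF c(1)]])
  have x: "smooth_on T x" unfolding T_def x_def by (rule smooth_on_curve_chart[OF \<sigma> c(1)])
  obtain r where r: "r > 0" "cball (x t0) r \<subseteq> chart_range ?c"
    using chart_ball[OF c] by (auto simp: x_def)
  let ?\<psi> = "bump (x t0) r" and ?B = "bump_field ?c (x t0) r"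
  define V where "V = T \<inter> x -` ball (x t0) r"
  have V: "open V"
    unfolding V_def by (rule continuous_open_preimage[OF smooth_on_imp_continuous_on[OF x] T open_ball])
  have "V \<subseteq> T" "V \<subseteq> J" by (auto simp: V_def T_def)
  note xV = smooth_on_subset[OF x \<open>V \<subseteq> T\<close>]
  have pos: "?\<psi> (x t) > 0" if "t \<in> V" for t
    using that by (intro bump_pos) (simp add: V_def)
  have \<Phi>B: "smooth_on V (\<lambda>t. \<Phi> (\<sigma> t) (?B b (\<sigma> t)))" for b
  proof -
    have "smooth_fun M (\<lambda>p. \<Phi> p (?B b p))"
      using \<Phi> vector_field_bump_field[OF c(1) r] by (simp add: one_form_def)
    then have "smooth_on (chart_range ?c) ((\<lambda>p. \<Phi> p (?B b p)) \<circ> chart_inv ?c)"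
      using c(1) by (simp add: smooth_fun_def)
    from smooth_on_compose[OF V xV this]
    have "smooth_on V (\<lambda>t. ((\<lambda>p. \<Phi> p (?B b p)) \<circ> chart_inv ?c) (x t))"
      by (auto simp: V_def T_def x_def)
    then show ?thesis
      by (rule smooth_on_cong[THEN iffD1, OF V, rotated])
        (auto simp: V_def T_def x_def chart_inv_chart[OF c(1)])
  qed
  have "smooth_on V (\<lambda>t. ?\<psi> (x t))"
    by (rule smooth_on_compose[OF V xV smooth_on_bump[OF open_UNIV]]) simp
  then have inv: "smooth_on V (\<lambda>t. inverse (?\<psi> (x t)))"
    by (rule smooth_on_inverse[OF V]) (use pos in force)
  have coeff: "smooth_on V (\<lambda>t. vector_derivative x (at t) \<bullet> b)" for b
    by (rule smooth_on_inner[OF V smooth_on_vector_derivative[OF V xV] smooth_on_const[OF V]])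
  have sm: "smooth_on V (\<lambda>t. \<Sum>b\<in>Basis. (vector_derivative x (at t) \<bullet> b) *
      (\<Phi> (\<sigma> t) (?B b (\<sigma> t)) * inverse (?\<psi> (x t))))"
    by (rule smooth_on_sum[OF V smooth_on_mult[OF V coeff smooth_on_mult[OF V \<Phi>B inv]]])
  have eq: "(\<Sum>b\<in>Basis. (vector_derivative x (at t) \<bullet> b) *
      (\<Phi> (\<sigma> t) (?B b (\<sigma> t)) * inverse (?\<psi> (x t)))) = \<Phi> (\<sigma> t) (velocity M \<sigma> t)"
    if t: "t \<in> V" for t
  proof -
    have tJ: "t \<in> J" and tc: "\<sigma> t \<in> chart_dom ?c" using t by (auto simp: V_def T_def)
    let ?L = "transition_deriv ?c (chart_at M (\<sigma> t)) (\<sigma> t)"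
    have L: "linear ?L"
      by (rule linear_transition_deriv[OF c(1) _ tc]) (rule chart_at[OF smooth_curve_in_points[OF \<sigma> tJ]])+
    have lin: "linear (\<Phi> (\<sigma> t))"
      using \<Phi> smooth_curve_in_points[OF \<sigma> tJ] by (simp add: one_form_def)
    let ?x' = "vector_derivative x (at t)"
    have "velocity M \<sigma> t = ?L ?x'"
      using transition_chart_at_tangent_coord[OF c(1) tc, of "velocity M \<sigma> t"]
        tangent_coord_velocity[OF \<sigma> c(1) tJ tc] by (simp add: x_def)
    also have "\<dots> = ?L (\<Sum>b\<in>Basis. (?x' \<bullet> b) *\<^sub>R b)" by (simp only: euclidean_representation)
    also have "\<dots> = (\<Sum>b\<in>Basis. (?x' \<bullet> b) *\<^sub>R ?L b)"
      by (simp only: linear_sum[OF L] linear_scale[OF L])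
    finally have "\<Phi> (\<sigma> t) (velocity M \<sigma> t) = (\<Sum>b\<in>Basis. (?x' \<bullet> b) * \<Phi> (\<sigma> t) (?L b))"
      by (simp only: linear_sum[OF lin] linear_scale[OF lin] real_scaleR_def)
    moreover have "\<Phi> (\<sigma> t) (?B b (\<sigma> t)) * inverse (?\<psi> (x t)) = \<Phi> (\<sigma> t) (?L b)" for b
    proof -
      have "?B b (\<sigma> t) = ?\<psi> (x t) *\<^sub>R ?L b" using tc by (simp add: bump_field_def x_def)
      then show ?thesis using pos[OF t] by (simp add: linear_scale[OF lin])
    qed
    ultimately show ?thesis by simp
  qed
  have "smooth_on V (\<lambda>t. \<Phi> (\<sigma> t) (velocity M \<sigma> t))"
    by (rule smooth_on_cong[THEN iffD1, OF V eq sm])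
  moreover have "t0 \<in> V" using t0 c(2) r(1) by (simp add: V_def T_def)
  ultimately show "\<exists>U. open U \<and> t0 \<in> U \<and> smooth_on (U \<inter> J) (\<lambda>t. \<Phi> (\<sigma> t) (velocity M \<sigma> t))"
    using V \<open>V \<subseteq> J\<close> by (intro exI[of _ V]) (simp add: Int_absorb2)
qed

lemma smooth_curve_reparametrize:
  assumes \<sigma>: "smooth_curve M J \<sigma>" and \<theta>: "reparametrization J' J \<theta>"
  shows "smooth_curve M J' (\<sigma> \<circ> \<theta>)"
proof -
  have J: "open_interval J'" "open J'" "\<theta> ` J' = J" "smooth_on J' \<theta>"
    using \<theta> by (auto simp: reparametrization_def open_interval_def bij_betw_def)
  have cont: "continuous_on J' \<theta>" by (rule smooth_on_imp_continuous_on[OF J(4)])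
  then have "continuous_map (top_of_set J') (top_of_set J) \<theta>"
    using J(3) by (simp add: continuous_map_in_subtopology image_subset_iff_funcset[symmetric])
  moreover have "continuous_map (top_of_set J) (mtop M) \<sigma>" using \<sigma> by (simp add: smooth_curve_def)
  ultimately have "continuous_map (top_of_set J') (mtop M) (\<sigma> \<circ> \<theta>)" by (rule continuous_map_compose)
  moreover have "smooth_on {t \<in> J'. (\<sigma> \<circ> \<theta>) t \<in> chart_dom c} (chart_map c \<circ> (\<sigma> \<circ> \<theta>))"
    if c: "c \<in> atlas M" for c
  proof -
    let ?T = "{t \<in> J. \<sigma> t \<in> chart_dom c}" and ?T' = "{t \<in> J'. (\<sigma> \<circ> \<theta>) t \<in> chart_dom c}"
    have "?T' = J' \<inter> \<theta> -` ?T" using J(3) by auto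
    then have "open ?T'"
      using continuous_open_preimage[OF cont J(2) open_curve_preimage[OF \<sigma> openin_chart_dom[OF c]]] by simp
    moreover have "smooth_on ?T' \<theta>" by (rule smooth_on_subset[OF J(4)]) auto
    ultimately have "smooth_on ?T' (\<lambda>t. (chart_map c \<circ> \<sigma>) (\<theta> t))"
      by (rule smooth_on_compose[OF _ _ smooth_on_curve_chart[OF \<sigma> c]]) (use J(3) in auto)
    then show ?thesis by (simp add: o_def)
  qed
  ultimately show ?thesis using J(1) by (simp add: smooth_curve_def)
qed

lemma affine_connection_scale:
  assumes "affine_connection M nabla" "vector_field M X" "p \<in> points M"
  shows "nabla (\<lambda>q. k *\<^sub>R X q) (\<lambda>q. k *\<^sub>R X q) p = k\<^sup>2 *\<^sub>R nabla X X p"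
proof -
  note A = assms(1)[unfolded affine_connection_def, THEN conjunct2, THEN conjunct2]
  have "nabla (\<lambda>q. k *\<^sub>R X q) (\<lambda>q. k *\<^sub>R X q) p = k *\<^sub>R nabla X (\<lambda>q. k *\<^sub>R X q) p"
    using A[THEN conjunct1, rule_format, OF smooth_fun_const assms(2) vector_field_scale[OF assms(2)] assms(3)] .
  moreover have "nabla X (\<lambda>q. k *\<^sub>R X q) p = dir_deriv M p (X p) (\<lambda>q. k) *\<^sub>R X p + k *\<^sub>R nabla X X p"
    using A[THEN conjunct2, THEN conjunct2, rule_format, OF smooth_fun_const assms(2) assms(2) assms(3)] .
  ultimately show ?thesis by (simp add: dir_deriv_const power2_eq_square)
qed

text \<open>If \<open>\<sigma>\<close> solves the equation of geodesics of \<open>nabla\<close>, then in any chart \<open>x = \<sigma> \<circ> \<theta>\<close> satisfies that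
  of \<open>nablabar\<close> up to the multiple \<open>\<theta>'' + 2 \<Phi>(\<sigma>') \<theta>'\<^sup>2\<close> of \<open>\<sigma>'\<close>, and \<open>\<theta>\<close> can be chosen such that it vanishes.\<close>

lemma autoparallel_reparametrize:
  assumes aff: "affine_connection M nabla" and \<Phi>: "one_form M \<Phi>"
    and diff: "\<And>X p. vector_field M X \<Longrightarrow> p \<in> points M \<Longrightarrow>
      nablabar X X p = nabla X X p + (2 * \<Phi> p (X p)) *\<^sub>R X p"
    and auto: "autoparallel M nabla J \<sigma>"
  obtains J' \<theta> where "reparametrization J' J \<theta>" "autoparallel M nablabar J' (\<sigma> \<circ> \<theta>)"
proof -
  have \<sigma>: "smooth_curve M J \<sigma>" using auto by (simp add: autoparallel_def)
  have J: "open_interval J" using \<sigma> by (simp add: smooth_curve_def)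
  then have "open J" by (simp add: open_interval_def)
  define a where "a t = 2 * \<Phi> (\<sigma> t) (velocity M \<sigma> t)" for t
  have "smooth_on J a"
    unfolding a_def[abs_def] by (rule smooth_on_mult[OF \<open>open J\<close> smooth_on_const[OF \<open>open J\<close>]
          smooth_on_one_form_velocity[OF \<sigma> \<Phi>]])
  from reparametrization_equation_solution[OF J this]
  obtain J' \<theta> \<theta>' where rep: "reparametrization J' J \<theta>"
    and d\<theta>: "\<And>t. t \<in> J' \<Longrightarrow> (\<theta> has_real_derivative \<theta>' t) (at t)"
    and nz: "\<And>t. t \<in> J' \<Longrightarrow> \<theta>' t \<noteq> 0"
    and d\<theta>': "\<And>t. t \<in> J' \<Longrightarrow> (\<theta>' has_real_derivative - a (\<theta> t) * (\<theta>' t)\<^sup>2) (at t)"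
    by blast
  have im: "\<theta> t \<in> J" if "t \<in> J'" for t
    using rep that by (auto simp: reparametrization_def dest: bij_betwE)
  note \<sigma>\<theta> = smooth_curve_reparametrize[OF \<sigma> rep]
  have "vector_derivative (\<lambda>s. vector_derivative (chart_map c \<circ> (\<sigma> \<circ> \<theta>)) (at s)) (at t) +
        tangent_coord M c ((\<sigma> \<circ> \<theta>) t) (nablabar X' X' ((\<sigma> \<circ> \<theta>) t)) = 0"
    if t: "t \<in> J'" and c: "c \<in> atlas M" and tc: "(\<sigma> \<circ> \<theta>) t \<in> chart_dom c"
      and X': "extends_coord_field M c ((\<sigma> \<circ> \<theta>) t) (vector_derivative (chart_map c \<circ> (\<sigma> \<circ> \<theta>)) (at t)) X'"
    for t c X'
  proof -
    define p where "p = \<sigma> (\<theta> t)"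
    have p: "p \<in> points M" "p \<in> chart_dom c"
      using smooth_curve_in_points[OF \<sigma> im[OF t]] tc by (simp_all add: p_def)
    define x where "x = chart_map c \<circ> \<sigma>"
    define T where "T = {t \<in> J. \<sigma> t \<in> chart_dom c}"
    define T' where "T' = {t \<in> J'. (\<sigma> \<circ> \<theta>) t \<in> chart_dom c}"
    have T: "open T" "smooth_on T x"
      unfolding T_def x_def
      using open_curve_preimage[OF \<sigma> openin_chart_dom[OF c]] smooth_on_curve_chart[OF \<sigma> c] .
    have T': "open T'"
      unfolding T'_def by (rule open_curve_preimage[OF \<sigma>\<theta> openin_chart_dom[OF c]])
    have \<theta>T: "\<theta> s \<in> T" "s \<in> J'" if "s \<in> T'" for s using that im by (auto simp: T_def T'_def)
    have tT': "t \<in> T'" using t tc by (simp add: T'_def)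
    define x' where "x' s = vector_derivative x (at s)" for s
    define x'' where "x'' = vector_derivative x' (at (\<theta> t))"
    let ?k = "\<theta>' t"
    have chain: "((\<lambda>s. f (\<theta> s)) has_vector_derivative \<theta>' s *\<^sub>R vector_derivative f (at (\<theta> s))) (at s)"
      if "smooth_on T f" "s \<in> T'" for f :: "real \<Rightarrow> 'e" and s
      using vector_diff_chain_at[of \<theta> "\<theta>' s" s f] d\<theta>[OF \<theta>T(2)[OF that(2)]]
        smooth_on_has_vector_derivative[OF that(1) \<theta>T(1)[OF that(2)]]
      by (simp add: has_real_derivative_iff_has_vector_derivative o_def)
    have y': "vector_derivative (chart_map c \<circ> (\<sigma> \<circ> \<theta>)) (at s) = \<theta>' s *\<^sub>R x' (\<theta> s)" if "s \<in> T'" for s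
      using vector_derivative_at[OF chain[OF T(2) that]] by (simp add: x_def x'_def o_def)
    have "smooth_on T x'"
      unfolding x'_def[abs_def] by (rule smooth_on_vector_derivative[OF T])
    have "((\<lambda>s. \<theta>' s *\<^sub>R x' (\<theta> s)) has_vector_derivative
        ?k *\<^sub>R (?k *\<^sub>R x'') + (- a (\<theta> t) * ?k\<^sup>2) *\<^sub>R x' (\<theta> t)) (at t)"
      unfolding x''_def
      by (rule has_vector_derivative_scaleR[OF d\<theta>'[OF t] chain[OF \<open>smooth_on T x'\<close> tT']])
    then have "((\<lambda>s. vector_derivative (chart_map c \<circ> (\<sigma> \<circ> \<theta>)) (at s)) has_vector_derivative
        ?k *\<^sub>R (?k *\<^sub>R x'') + (- a (\<theta> t) * ?k\<^sup>2) *\<^sub>R x' (\<theta> t)) (at t)"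
      by (rule has_vector_derivative_transform_within_open[OF _ T' tT']) (simp add: y')
    then have y'': "vector_derivative (\<lambda>s. vector_derivative (chart_map c \<circ> (\<sigma> \<circ> \<theta>)) (at s)) (at t) =
        ?k *\<^sub>R (?k *\<^sub>R x'') + (- a (\<theta> t) * ?k\<^sup>2) *\<^sub>R x' (\<theta> t)"
      by (rule vector_derivative_at)
    define X where "X q = (1 / ?k) *\<^sub>R X' q" for q
    have X'X: "X' = (\<lambda>q. ?k *\<^sub>R X q)" using nz[OF t] by (simp add: X_def)
    obtain U where U: "vector_field M X'" "openin (mtop M) U" "p \<in> U" "U \<subseteq> chart_dom c"
      "\<And>q. q \<in> U \<Longrightarrow> tangent_coord M c q (X' q) = ?k *\<^sub>R x' (\<theta> t)"
      using X' y'[OF tT'] by (auto simp: extends_coord_field_def p_def)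
    have X: "vector_field M X" unfolding X_def[abs_def] by (rule vector_field_scale[OF U(1)])
    have tX: "tangent_coord M c q (X q) = x' (\<theta> t)" if "q \<in> U" for q
      using U(5)[OF that] nz[OF t] linear_scale[OF linear_tangent_coord[OF c]] U(4) that
      by (auto simp: X_def)
    then have "extends_coord_field M c (\<sigma> (\<theta> t)) (vector_derivative (chart_map c \<circ> \<sigma>) (at (\<theta> t))) X"
      using X U(2-4) by (auto simp: extends_coord_field_def p_def x'_def x_def)
    then have geo: "x'' + tangent_coord M c p (nabla X X p) = 0"
      using auto im[OF t] c p(2)
      by (auto simp: autoparallel_def x''_def x'_def[abs_def] x_def p_def)
    have vel: "X p = velocity M \<sigma> (\<theta> t)"
      using tX[OF U(3)] tangent_coord_velocity[OF \<sigma> c im[OF t]] p(2)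
        tangent_coord_inject[OF c p(2), of "X p" "velocity M \<sigma> (\<theta> t)"]
      by (simp add: p_def x'_def x_def)
    have lin: "linear (\<Phi> p)" using \<Phi> p(1) by (simp add: one_form_def)
    have a: "a (\<theta> t) = 2 * \<Phi> p (X p)"
      unfolding vel a_def by (simp add: p_def)
    have "nablabar X' X' p = ?k\<^sup>2 *\<^sub>R nabla X X p + (a (\<theta> t) * ?k\<^sup>2) *\<^sub>R X p"
      using diff[OF U(1) p(1)] affine_connection_scale[OF aff X p(1), of ?k]
      by (simp add: X'X linear_scale[OF lin] a power2_eq_square mult_ac)
    then have "tangent_coord M c p (nablabar X' X' p) =
        ?k\<^sup>2 *\<^sub>R tangent_coord M c p (nabla X X p) + (a (\<theta> t) * ?k\<^sup>2) *\<^sub>R x' (\<theta> t)"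
      by (simp add: linear_add[OF linear_tangent_coord[OF c p(2)]]
          linear_scale[OF linear_tangent_coord[OF c p(2)]] tX[OF U(3)])
    moreover have "tangent_coord M c p (nabla X X p) = - x''"
      using geo by (simp add: eq_neg_iff_add_eq_0 add.commute)
    ultimately show ?thesis
      unfolding y'' by (simp add: p_def power2_eq_square)
  qed
  then have "autoparallel M nablabar J' (\<sigma> \<circ> \<theta>)"
    unfolding autoparallel_def using \<sigma>\<theta> by blast
  with rep show ?thesis by (rule that)
qed

text \<open>Only one direction, as the roles of the two metrics are exchanged by \<open>\<Phi> \<mapsto> - \<Phi>\<close>.\<close>

lemma unparametrized_geodesic_transfer:
  assumes g: "riemannian_metric M g"
    and lc: "levi_civita M g nabla" "levi_civita M gbar nablabar" and \<Phi>: "one_form M \<Phi>"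
    and diff: "\<And>X p. vector_field M X \<Longrightarrow> p \<in> points M \<Longrightarrow>
      nablabar X X p = nabla X X p + (2 * \<Phi> p (X p)) *\<^sub>R X p"
    and "unparametrized_geodesic M g I \<gamma>"
  shows "unparametrized_geodesic M gbar I \<gamma>"
proof -
  obtain J \<tau> nabla' where \<tau>: "reparametrization J I \<tau>" and lc': "levi_civita M g nabla'"
    and auto': "autoparallel M nabla' J (\<gamma> \<circ> \<tau>)"
    using assms(6) by (auto simp: unparametrized_geodesic_def geodesic_def)
  have \<sigma>: "smooth_curve M J (\<gamma> \<circ> \<tau>)" using auto' by (simp add: autoparallel_def)
  have "nabla X X ((\<gamma> \<circ> \<tau>) t) = nabla' X X ((\<gamma> \<circ> \<tau>) t)"
    if "t \<in> J" "extends_coord_field M c ((\<gamma> \<circ> \<tau>) t) u X" for t c u X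
    using that(2) smooth_curve_in_points[OF \<sigma> that(1)]
    by (intro levi_civita_unique[OF g lc(1) lc']) (simp_all add: extends_coord_field_def)
  \<comment> \<open>The connection provided by the hypothesis on \<open>\<gamma>\<close> may be replaced by \<open>nabla\<close>.\<close>
  with auto' have "autoparallel M nabla J (\<gamma> \<circ> \<tau>)"
    by (simp add: autoparallel_def)
  from autoparallel_reparametrize[where nablabar = nablabar and \<Phi> = \<Phi>,
      OF levi_civitaD(1)[OF lc(1)] \<Phi> diff this]
  obtain J' \<theta> where \<theta>: "reparametrization J' J \<theta>" and "autoparallel M nablabar J' (\<gamma> \<circ> \<tau> \<circ> \<theta>)"
    by blast
  then have "geodesic M gbar J' (\<gamma> \<circ> (\<tau> \<circ> \<theta>))"
    using lc(2) by (auto simp: geodesic_def o_assoc)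
  then show ?thesis
    using reparametrization_compose[OF \<tau> \<theta>] by (auto simp: unparametrized_geodesic_def)
qed

end

section \<open>Projective equivalence\<close>

theorem theorem2:
  fixes M :: "('a, 'e::euclidean_space) manifold"
    and g gbar :: "'a \<Rightarrow> 'e \<Rightarrow> 'e \<Rightarrow> real"
    and P Q :: "'a \<Rightarrow> 'e \<Rightarrow> 'e"
    and \<epsilon> :: real
  assumes "smooth_manifold M"
    and "riemannian_metric M g" and "riemannian_metric M gbar"
    and "endo_field M P" and "endo_field M Q"
    and "\<epsilon> \<noteq> 1" and "\<epsilon> \<noteq> real DIM('e) + 1"
    and "PQ_compatible M P Q \<epsilon> g gbar"
    and "PQ_projective M P Q g gbar"
    and "\<epsilon> = 0"
  shows "projectively_equivalent M g gbar"
proof -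
  interpret smooth_mfd M by standard (fact assms(1))
  obtain nabla nablabar \<Phi> where lc: "levi_civita M g nabla" "levi_civita M gbar nablabar"
    and \<Phi>: "one_form M \<Phi>"
    and D: "\<And>X Y p. vector_field M X \<Longrightarrow> vector_field M Y \<Longrightarrow> p \<in> points M \<Longrightarrow>
        nablabar X Y p - nabla X Y p =
              \<Phi> p (X p) *\<^sub>R Y p + \<Phi> p (Y p) *\<^sub>R X p
              - \<Phi> p (P p (X p)) *\<^sub>R Q p (Y p) - \<Phi> p (P p (Y p)) *\<^sub>R Q p (X p)"
    using assms(9) unfolding PQ_projective_def by blast
  have "\<Phi> p (P p v) = 0" if "p \<in> points M" for p v
    using one_form_P_zero[OF assms(2-4) assms(8)[unfolded assms(10)] lc \<Phi> D that] .
  then have diff: "nablabar X X p - nabla X X p = (2 * \<Phi> p (X p)) *\<^sub>R X p"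
    if "vector_field M X" "p \<in> points M" for X p
    using D[OF that(1) that(1) that(2)] that(2) by (simp add: scaleR_left_distrib[symmetric])
  have to: "nablabar X X p = nabla X X p + (2 * \<Phi> p (X p)) *\<^sub>R X p"
    and fro: "nabla X X p = nablabar X X p + (2 * - \<Phi> p (X p)) *\<^sub>R X p"
    if "vector_field M X" "p \<in> points M" for X p
    using diff[OF that] by (simp_all add: algebra_simps)
  show ?thesis
    unfolding projectively_equivalent_def
    using unparametrized_geodesic_transfer[OF assms(2) lc \<Phi> to]
      unparametrized_geodesic_transfer[OF assms(3) lc(2,1) one_form_uminus[OF \<Phi>] fro] by blast
qed

end
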